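(* Let $\beta\in[0,1)$ and let $U:\mathbb{R}^d\to\mathbb{R}$ satisfy: (i) $U$ is twice continuously differentiable, $\nabla U(0)=0$, and $\sup_x\|\mathrm{D}^2U(x)\|\le\mathtt{L}$ for some $\mathtt{L}\ge0$; (ii) there exist $\mathtt{m}_\beta>0$ and $\mathtt{L}_\beta,\mathtt{K}_\beta\ge0$ such that for all $x,y\in\mathbb{R}^d$ with $\|x\|\ge\mathtt{K}_\beta$ and $\|y\|=1$, $$\frac{\mathtt{L}_\beta}{1+\|x\|^{3\beta/4}}\ge \mathrm{D}^2U(x)[y,y]\ge\frac{\mathtt{m}_\beta}{1+\|x\|^\beta}.$$ Let $\bar\eta_\beta=\mathtt{m}_\beta/2^5$ and $W_{\bar\eta_\beta}(x)=\exp\{\bar\eta_\beta(1+\|x\|^2)^{1/2}\}$. Then there exists $\Gamma_\beta>0$ such that for every $\gamma\in(0,\Gamma_\beta]$ there exist $C_{\gamma,\beta}\ge0$ and $\rho_{\gamma,\beta}\in[0,1)$ such that for all $x\in\mathbb{R}^d$ and $k\in\mathbb{N}$, $$\|\delta_xR_\gamma^k-\pi\|_{W_{\bar\eta_\beta}}\le C_{\gamma,\beta}\rho_{\gamma,\beta}^kW_{\bar\eta_\beta}(x).$$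
   Context: $\pi$ denotes the probability density proportional to $e^{-U}$ and the associated measure. For $\gamma>0$, $r_\gamma(x,y)=(4\pi\gamma)^{-d/2}\exp(-\|y-x+\gamma\nabla U(x)\|^2/(4\gamma))$, $\alpha_\gamma(x,y)=1\wedge\frac{\pi(y)r_\gamma(y,x)}{\pi(x)r_\gamma(x,y)}$, and the MALA kernel is $R_\gamma(x,A)=\int\mathbb{1}_A(y)\alpha_\gamma(x,y)r_\gamma(x,y)dy+\delta_x(A)\int\{1-\alpha_\gamma(x,y)\}r_\gamma(x,y)dy$. For $V\ge1$ measurable and a finite signed measure $\mu$, $\|\mu\|_V=\sup\{|\int fd\mu|:\sup_x|f(x)|/V(x)\le1\}$. *)

theory Defs
  imports "HOL-Probability.Probability"
begin

text \<open>Real power with the convention t^0 = 1 (also at t = 0).\<close>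
definition rpow :: "real \<Rightarrow> real \<Rightarrow> real" where
  "rpow t a = (if a = 0 then 1 else t powr a)"

definition norm_const :: "('a::euclidean_space \<Rightarrow> real) \<Rightarrow> real" where
  "norm_const U = (\<integral>x. exp (- U x) \<partial>lborel)"

definition pi_dens :: "('a::euclidean_space \<Rightarrow> real) \<Rightarrow> 'a \<Rightarrow> real" where
  "pi_dens U x = exp (- U x) / norm_const U"

definition pi_meas :: "('a::euclidean_space \<Rightarrow> real) \<Rightarrow> 'a measure" where
  "pi_meas U = density lborel (\<lambda>x. ennreal (pi_dens U x))"

text \<open>Proposal density r_gamma(x,y); gU is the gradient of U.\<close>
definition prop_dens :: "('a::euclidean_space \<Rightarrow> 'a) \<Rightarrow> real \<Rightarrow> 'a \<Rightarrow> 'a \<Rightarrow> real" where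
  "prop_dens gU \<gamma> x y =
     (4 * pi * \<gamma>) powr (- real DIM('a) / 2) *
     exp (- (norm (y - x + \<gamma> *\<^sub>R gU x))\<^sup>2 / (4 * \<gamma>))"

definition accept :: "('a::euclidean_space \<Rightarrow> real) \<Rightarrow> ('a \<Rightarrow> 'a) \<Rightarrow> real \<Rightarrow> 'a \<Rightarrow> 'a \<Rightarrow> real" where
  "accept U gU \<gamma> x y =
     min 1 ((pi_dens U y * prop_dens gU \<gamma> y x) / (pi_dens U x * prop_dens gU \<gamma> x y))"

definition MALA :: "('a::euclidean_space \<Rightarrow> real) \<Rightarrow> ('a \<Rightarrow> 'a) \<Rightarrow> real \<Rightarrow> 'a \<Rightarrow> 'a measure" where
  "MALA U gU \<gamma> x = measure_of UNIV (sets borel)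
     (\<lambda>A. (\<integral>\<^sup>+ y. indicator A y * ennreal (accept U gU \<gamma> x y * prop_dens gU \<gamma> x y) \<partial>lborel)
        + indicator A x * (\<integral>\<^sup>+ y. ennreal ((1 - accept U gU \<gamma> x y) * prop_dens gU \<gamma> x y) \<partial>lborel))"

fun MALA_iter :: "('a::euclidean_space \<Rightarrow> real) \<Rightarrow> ('a \<Rightarrow> 'a) \<Rightarrow> real \<Rightarrow> nat \<Rightarrow> 'a \<Rightarrow> 'a measure" where
  "MALA_iter U gU \<gamma> 0 x = return borel x"
| "MALA_iter U gU \<gamma> (Suc k) x = bind (MALA_iter U gU \<gamma> k x) (MALA U gU \<gamma>)"

text \<open>V-norm of the signed measure M - N: supremum of |int f dM - int f dN| over measurable f
  with |f| <= V (restricted to f integrable w.r.t. both, which gives the same supremum, possibly infinity).\<close>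
definition Vnorm :: "'a::euclidean_space measure \<Rightarrow> 'a measure \<Rightarrow> ('a \<Rightarrow> real) \<Rightarrow> ereal" where
  "Vnorm M N V = (SUP f \<in> {f. f \<in> borel_measurable borel \<and> (\<forall>x. \<bar>f x\<bar> \<le> V x)
                            \<and> integrable M f \<and> integrable N f}.
                   ereal \<bar>(\<integral>x. f x \<partial>M) - (\<integral>x. f x \<partial>N)\<bar>)"

end

theory Submission
  imports Defs "HOL-Real_Asymp.Real_Asymp"
begin

text \<open>
  The theorem follows from Harris' theorem, proved by contraction of the weighted oscillation of
  Hairer and Mattingly. Its hypotheses are a geometric drift condition for the weight \<open>W\<close>, a
  minorization on the level sets of \<open>W\<close> (the accepted part of the kernel has a positive continuous
  density), and invariance of \<open>\<pi>\<close> by detailed balance.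

  For the drift, \<open>\<beta> < 1\<close> and tail convexity give \<open>\<parallel>x\<parallel> - \<parallel>x - \<gamma> \<nabla>U(x)\<parallel> \<rightarrow> \<infinity>\<close>, so the proposal
  satisfies \<open>\<integral> W(y) r\<^sub>\<gamma>(x,y) dy = o(W(x))\<close>; it remains to bound the acceptance probability from
  below for large \<open>x\<close>. With \<open>h = y - x\<close>, \<open>w = h + \<gamma> \<nabla>U(x)\<close> and \<open>D = \<nabla>U(y) - \<nabla>U(x)\<close>, the logarithm
  of the acceptance ratio is
  \<open>U(x) - U(y) + \<langle>\<nabla>U(y), h\<rangle> - \<langle>w, D\<rangle> / 2 - \<gamma> \<parallel>D\<parallel>\<^sup>2 / 4\<close>.
  The Taylor remainder is at least of order \<open>\<parallel>x\<parallel>\<^sup>-\<^sup>\<beta> \<parallel>h\<parallel>\<^sup>2\<close>, while \<open>\<parallel>D\<parallel>\<^sup>2\<close> is at most of order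
  \<open>\<parallel>x\<parallel>\<^sup>-\<^sup>3\<^sup>\<beta>\<^sup>/\<^sup>2 \<parallel>h\<parallel>\<^sup>2\<close>; hence on the event \<open>\<parallel>w\<parallel>\<^sup>2 \<le> 2 \<gamma>\<close> the ratio is at least \<open>exp (-1/2)\<close> for small \<open>\<gamma>\<close>.
\<close>

section \<open>Positive semidefinite operators\<close>

lemma quadratic_form_eq_sgn:
  fixes A :: "'a::real_inner \<Rightarrow> 'a"
  assumes "linear A"
  shows "A v \<bullet> v = (A (sgn v) \<bullet> sgn v) * (norm v)\<^sup>2"
proof -
  interpret linear A by fact
  have "A v \<bullet> v = A (norm v *\<^sub>R sgn v) \<bullet> (norm v *\<^sub>R sgn v)"
    by (cases "v = 0") (simp_all add: sgn_div_norm)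
  then show ?thesis
    by (simp add: scaleR power2_eq_square)
qed

locale psd_operator = linear A for A :: "'a::real_inner \<Rightarrow> 'a" +
  fixes M :: real
  assumes self_adjoint: "A v \<bullet> w = v \<bullet> A w"
    and nonneg: "0 \<le> A v \<bullet> v"
    and upper: "A v \<bullet> v \<le> M * (norm v)\<^sup>2"
begin

lemma norm_sq_le: "(norm (A v))\<^sup>2 \<le> M * (A v \<bullet> v)"
proof (cases "A v = 0")
  case False
  define w where "w = A v"
  have quad: "2 * s * (norm w)\<^sup>2 \<le> A v \<bullet> v + s\<^sup>2 * (M * (norm w)\<^sup>2)" for s
  proof -
    have "0 \<le> A (v - s *\<^sub>R w) \<bullet> (v - s *\<^sub>R w)"
      by (rule nonneg)
    also have "\<dots> = A v \<bullet> v - 2 * s * (norm w)\<^sup>2 + s\<^sup>2 * (A w \<bullet> w)"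
      using self_adjoint[of w v]
      by (simp add: diff scaleR inner_simps w_def power2_norm_eq_inner algebra_simps
          power2_eq_square[of s] inner_commute)
    also have "\<dots> \<le> A v \<bullet> v - 2 * s * (norm w)\<^sup>2 + s\<^sup>2 * (M * (norm w)\<^sup>2)"
      using upper[of w] by (simp add: mult_left_mono)
    finally show ?thesis by simp
  qed
  have "0 \<le> M * (norm w)\<^sup>2"
    using nonneg[of w] upper[of w] by linarith
  then consider (zero) "M = 0" | (pos) "0 < M"
    using False by (fastforce simp: w_def zero_le_mult_iff)
  then show ?thesis
  proof cases
    case zero
    have "(norm w)\<^sup>2 \<le> 0"
      using quad[of 1] upper[of v] unfolding zero by linarith
    then show ?thesis
      using False by (simp add: w_def)
  next
    case pos
    then show ?thesis
      using quad[of "1 / M"] by (simp add: w_def field_simps power2_eq_square)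
  qed
qed simp

lemma norm_le: "norm (A v) \<le> M * norm v"
proof (cases "v = 0")
  case False
  have "0 \<le> M * (norm v)\<^sup>2"
    using nonneg[of v] upper[of v] by linarith
  then have M: "0 \<le> M"
    using False by (simp add: zero_le_mult_iff)
  have "(norm (A v))\<^sup>2 \<le> M * (M * (norm v)\<^sup>2)"
    using norm_sq_le[of v] mult_left_mono[OF upper M] by (rule order_trans)
  also have "\<dots> = (M * norm v)\<^sup>2"
    by (simp add: power2_eq_square)
  finally show ?thesis
    using M by (auto intro: power2_le_imp_le)
qed simp

lemma norm_diff_scaled_le:
  assumes "0 \<le> \<gamma>" "\<gamma> * M \<le> 1" and lower: "c * (norm v)\<^sup>2 \<le> A v \<bullet> v"
  shows "norm (v - \<gamma> *\<^sub>R A v) \<le> (1 - \<gamma> * c / 2) * norm v"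
proof (cases "v = 0")
  case False
  have "c * (norm v)\<^sup>2 \<le> M * (norm v)\<^sup>2"
    using lower upper by (rule order_trans)
  then have "\<gamma> * c \<le> 1"
    using False assms mult_left_mono[of c M \<gamma>] by simp
  have "\<gamma>\<^sup>2 * (norm (A v))\<^sup>2 \<le> \<gamma>\<^sup>2 * (M * (A v \<bullet> v))"
    by (intro mult_left_mono norm_sq_le) simp
  also have "\<dots> = (\<gamma> * M) * (\<gamma> * (A v \<bullet> v))"
    by (simp add: power2_eq_square)
  also have "\<dots> \<le> 1 * (\<gamma> * (A v \<bullet> v))"
    using assms nonneg by (intro mult_right_mono) auto
  finally have sq_step: "\<gamma>\<^sup>2 * (norm (A v))\<^sup>2 \<le> \<gamma> * (A v \<bullet> v)"
    by simp
  have "(norm (v - \<gamma> *\<^sub>R A v))\<^sup>2 = (norm v)\<^sup>2 - 2 * \<gamma> * (A v \<bullet> v) + \<gamma>\<^sup>2 * (norm (A v))\<^sup>2"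
    unfolding power2_norm_eq_inner by (simp add: inner_simps inner_commute power2_eq_square)
  also have "\<dots> \<le> (norm v)\<^sup>2 - \<gamma> * (c * (norm v)\<^sup>2)"
    using sq_step mult_left_mono[OF lower, of \<gamma>] assms by simp
  also have "\<dots> \<le> (norm v)\<^sup>2 - \<gamma> * (c * (norm v)\<^sup>2) + (\<gamma> * c * norm v / 2)\<^sup>2"
    by simp
  also have "\<dots> = ((1 - \<gamma> * c / 2) * norm v)\<^sup>2"
    by (simp add: power2_eq_square algebra_simps)
  finally show ?thesis
    using \<open>\<gamma> * c \<le> 1\<close> by (auto intro: power2_le_imp_le)
qed simp

end

section \<open>Twice differentiable functions\<close>

lemma has_real_derivative_along_line:
  fixes f :: "'a::real_normed_vector \<Rightarrow> real"
  assumes "(f has_derivative f') (at (x + t *\<^sub>R h))"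
  shows "((\<lambda>t. f (x + t *\<^sub>R h)) has_real_derivative f' h) (at t)"
proof -
  interpret bounded_linear f'
    using assms by (rule has_derivative_bounded_linear)
  have "((\<lambda>t. f (x + t *\<^sub>R h)) has_derivative (\<lambda>s. f' (s *\<^sub>R h))) (at t)"
    by (rule has_derivative_compose[where f = "\<lambda>t. x + t *\<^sub>R h", OF _ assms])
      (auto intro!: derivative_eq_intros)
  then show ?thesis
    by (simp add: has_field_derivative_def scaleR mult_commute_abs)
qed

lemma has_derivative_two_point:
  fixes g :: "'a::real_normed_vector \<Rightarrow> 'b::real_normed_vector"
  assumes "(g has_derivative H) (at x)" "0 < e"
  obtains d where "0 < d" "\<And>y z. norm (y - x) < d \<Longrightarrow> norm (z - x) < d \<Longrightarrow>
    norm (g y - g z - H (y - z)) \<le> e * (norm (y - x) + norm (z - x))"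
proof -
  interpret bounded_linear H
    using assms(1) by (rule has_derivative_bounded_linear)
  obtain d where d: "0 < d"
    "\<And>y. norm (y - x) < d \<Longrightarrow> norm (g y - g x - H (y - x)) \<le> e * norm (y - x)"
    using assms unfolding has_derivative_at_alt by blast
  have "norm (g y - g z - H (y - z)) \<le> e * (norm (y - x) + norm (z - x))"
    if "norm (y - x) < d" "norm (z - x) < d" for y z
  proof -
    have "norm (g y - g z - H (y - z)) = norm ((g y - g x - H (y - x)) - (g z - g x - H (z - x)))"
      by (simp add: diff algebra_simps)
    also have "\<dots> \<le> norm (g y - g x - H (y - x)) + norm (g z - g x - H (z - x))"
      by (rule norm_triangle_ineq4)
    also have "\<dots> \<le> e * (norm (y - x) + norm (z - x))"
      unfolding distrib_left by (intro add_mono d that)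
    finally show ?thesis .
  qed
  then show thesis
    using d(1) that by blast
qed

definition second_difference :: "('a::real_vector \<Rightarrow> real) \<Rightarrow> 'a \<Rightarrow> 'a \<Rightarrow> 'a \<Rightarrow> real" where
  "second_difference f x h k = f (x + k + h) - f (x + k) - f (x + h) + f x"

lemma second_difference_commute: "second_difference f x h k = second_difference f x k h"
  by (simp add: second_difference_def algebra_simps)

lemma second_difference_mean_value:
  fixes f :: "'a::real_inner \<Rightarrow> real"
  assumes grad: "\<And>y. (f has_derivative (\<lambda>v. g y \<bullet> v)) (at y)" and "0 < t"
  obtains s where "0 < s" "s < t"
    "second_difference f x (t *\<^sub>R h) k = t * ((g (x + k + s *\<^sub>R h) - g (x + s *\<^sub>R h)) \<bullet> h)"
proof -
  define \<psi> where "\<psi> s = f (x + k + s *\<^sub>R h) - f (x + s *\<^sub>R h)" for s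
  have "(\<psi> has_real_derivative (g (x + k + s *\<^sub>R h) - g (x + s *\<^sub>R h)) \<bullet> h) (at s)" for s
    unfolding \<psi>_def inner_diff_left
    by (intro DERIV_diff has_real_derivative_along_line grad)
  then obtain s where "0 < s" "s < t"
    "\<psi> t - \<psi> 0 = (t - 0) * ((g (x + k + s *\<^sub>R h) - g (x + s *\<^sub>R h)) \<bullet> h)"
    using MVT2[OF \<open>0 < t\<close>, of \<psi> "\<lambda>s. (g (x + k + s *\<^sub>R h) - g (x + s *\<^sub>R h)) \<bullet> h"]
    by blast
  then show thesis
    by (intro that[of s]) (simp_all add: \<psi>_def second_difference_def)
qed

lemma second_difference_approx:
  fixes f :: "'a::real_inner \<Rightarrow> real"
  assumes grad: "\<And>y. (f has_derivative (\<lambda>v. g y \<bullet> v)) (at y)"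
    and hess: "(g has_derivative H) (at x)" and "0 < e"
  obtains d where "0 < d" "\<And>t. 0 < t \<Longrightarrow> t * (norm h + norm k) < d \<Longrightarrow>
    \<bar>second_difference f x (t *\<^sub>R h) (t *\<^sub>R k) / t\<^sup>2 - H k \<bullet> h\<bar> \<le> 2 * e * (norm h + norm k) * norm h"
proof -
  obtain d where d: "0 < d" "\<And>y z. norm (y - x) < d \<Longrightarrow> norm (z - x) < d \<Longrightarrow>
      norm (g y - g z - H (y - z)) \<le> e * (norm (y - x) + norm (z - x))"
    using has_derivative_two_point[OF hess \<open>0 < e\<close>] by blast
  define N where "N = norm h + norm k"
  have "\<bar>second_difference f x (t *\<^sub>R h) (t *\<^sub>R k) / t\<^sup>2 - H k \<bullet> h\<bar> \<le> 2 * e * N * norm h"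
    if t: "0 < t" "t * N < d" for t
  proof -
    obtain s where s: "0 < s" "s < t" "second_difference f x (t *\<^sub>R h) (t *\<^sub>R k)
        = t * ((g (x + t *\<^sub>R k + s *\<^sub>R h) - g (x + s *\<^sub>R h)) \<bullet> h)"
      using second_difference_mean_value[OF grad t(1)] by blast
    define y where "y = x + t *\<^sub>R k + s *\<^sub>R h"
    define z where "z = x + s *\<^sub>R h"
    have "norm (y - x) \<le> t * norm k + s * norm h" "norm (z - x) = s * norm h"
      using norm_triangle_ineq[of "t *\<^sub>R k" "s *\<^sub>R h"] s t by (simp_all add: y_def z_def add.assoc)
    moreover have "s * norm h \<le> t * norm h" "0 \<le> t * norm k"
      using s by (simp_all add: mult_right_mono)
    ultimately have near: "norm (y - x) \<le> t * N" "norm (z - x) \<le> t * N"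
      by (simp_all add: N_def distrib_left)
    then have "norm (g y - g z - H (y - z)) \<le> e * (norm (y - x) + norm (z - x))"
      using t by (intro d) linarith+
    also have "\<dots> \<le> e * (2 * t * N)"
      using near \<open>0 < e\<close> by (intro mult_left_mono) auto
    also have "y - z = t *\<^sub>R k"
      by (simp add: y_def z_def)
    finally have "\<bar>(g y - g z - H (t *\<^sub>R k)) \<bullet> h\<bar> \<le> e * (2 * t * N) * norm h"
      by (intro order_trans[OF Cauchy_Schwarz_ineq2] mult_right_mono) auto
    then have "\<bar>(g y - g z) \<bullet> h / t - H k \<bullet> h\<bar> \<le> 2 * e * N * norm h"
      using t linear_scale[OF has_derivative_linear[OF hess]]
      by (simp add: inner_simps field_simps abs_le_iff)
    then show ?thesis
      using t unfolding s(3) y_def z_def by (simp add: power2_eq_square)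
  qed
  then show thesis
    using that[OF d(1)] unfolding N_def by blast
qed

lemma second_difference_tendsto:
  fixes f :: "'a::real_inner \<Rightarrow> real"
  assumes grad: "\<And>y. (f has_derivative (\<lambda>v. g y \<bullet> v)) (at y)"
    and hess: "(g has_derivative H) (at x)"
  shows "((\<lambda>t. second_difference f x (t *\<^sub>R h) (t *\<^sub>R k) / t\<^sup>2) \<longlongrightarrow> H k \<bullet> h) (at_right 0)"
proof (rule tendstoI)
  fix e :: real assume "0 < e"
  define N where "N = norm h + norm k"
  have N: "0 \<le> N"
    by (simp add: N_def)
  define e' where "e' = e / (2 * N * norm h + 1)"
  have "0 < 2 * N * norm h + 1"
    using N by (simp add: add_nonneg_pos)
  then have e': "0 < e'" "2 * e' * N * norm h < e"
    using \<open>0 < e\<close> by (simp_all add: e'_def field_simps)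
  obtain d where d: "0 < d" "\<And>t. 0 < t \<Longrightarrow> t * N < d \<Longrightarrow>
      \<bar>second_difference f x (t *\<^sub>R h) (t *\<^sub>R k) / t\<^sup>2 - H k \<bullet> h\<bar> \<le> 2 * e' * N * norm h"
    unfolding N_def using second_difference_approx[OF grad hess \<open>0 < e'\<close>, of h k] by blast
  have "dist (second_difference f x (t *\<^sub>R h) (t *\<^sub>R k) / t\<^sup>2) (H k \<bullet> h) < e"
    if t: "0 < t" "t < d / (N + 1)" for t
  proof -
    have "t * N \<le> t * (N + 1)" "t * (N + 1) < d"
      using t N by (simp_all add: field_simps)
    then show ?thesis
      unfolding dist_real_def using d(2)[OF t(1)] e'(2) by linarith
  qed
  then show "\<forall>\<^sub>F t in at_right 0. dist (second_difference f x (t *\<^sub>R h) (t *\<^sub>R k) / t\<^sup>2) (H k \<bullet> h) < e"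
    unfolding eventually_at_right_field using d N by (intro exI[of _ "d / (N + 1)"]) simp
qed

lemma symmetric_second_derivative:
  fixes f :: "'a::real_inner \<Rightarrow> real"
  assumes "\<And>y. (f has_derivative (\<lambda>v. g y \<bullet> v)) (at y)" and "(g has_derivative H) (at x)"
  shows "H h \<bullet> k = h \<bullet> H k"
proof -
  have "H h \<bullet> k = H k \<bullet> h"
    using second_difference_tendsto[OF assms, of k h]
    by (intro tendsto_unique[OF trivial_limit_at_right_real _ second_difference_tendsto[OF assms]])
      (simp add: second_difference_commute)
  then show ?thesis
    by (simp add: inner_commute)
qed

lemma taylor_lower_bound:
  fixes f :: "'a::real_inner \<Rightarrow> real"
  assumes grad: "\<And>y. (f has_derivative (\<lambda>v. g y \<bullet> v)) (at y)"
    and hess: "\<And>y. (g has_derivative H y) (at y)"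
    and lower: "\<And>t. 0 < t \<Longrightarrow> t < 1 \<Longrightarrow> c * (norm h)\<^sup>2 \<le> H (x + t *\<^sub>R h) h \<bullet> h"
  shows "f x + g x \<bullet> h + c / 2 * (norm h)\<^sup>2 \<le> f (x + h)"
proof -
  define D where "D = nth [\<lambda>t. f (x + t *\<^sub>R h), \<lambda>t. g (x + t *\<^sub>R h) \<bullet> h, \<lambda>t. H (x + t *\<^sub>R h) h \<bullet> h]"
  have "((\<lambda>t. g (x + t *\<^sub>R h) \<bullet> h) has_real_derivative H (x + t *\<^sub>R h) h \<bullet> h) (at t)" for t
    using has_derivative_inner_left[OF hess] by (rule has_real_derivative_along_line)
  then have "DERIV (D m) t :> D (Suc m) t" if "m < 2" for m t
    using that has_real_derivative_along_line[OF grad] by (auto simp: D_def less_2_cases_iff)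
  then obtain t where "0 < t" "t < 1"
    "f (x + 1 *\<^sub>R h) = (\<Sum>m<2. (D m 0 / fact m) * (1 - 0) ^ m) + (D 2 t / fact 2) * (1 - 0)\<^sup>2"
    using Taylor_up[of 2 D "\<lambda>t. f (x + t *\<^sub>R h)" 0 1 0] by (auto simp: D_def)
  then show ?thesis
    using lower[of t] by (simp add: D_def numeral_2_eq_2)
qed

section \<open>Potentials with convex tails\<close>

definition gradient_step :: "('a::real_vector \<Rightarrow> 'a) \<Rightarrow> real \<Rightarrow> 'a \<Rightarrow> 'a" where
  "gradient_step g \<gamma> x = x - \<gamma> *\<^sub>R g x"

lemma norm_segment_bounds:
  fixes x :: "'a::real_normed_vector"
  assumes "2 * norm h \<le> norm x" "0 \<le> t" "t \<le> 1"
  shows "norm x / 2 \<le> norm (x + t *\<^sub>R h)" "norm (x + t *\<^sub>R h) \<le> 3 * (norm x / 2)"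
proof -
  have "norm (t *\<^sub>R h) \<le> norm x / 2"
    using assms mult_left_le_one_le[of "norm h" t] by simp
  then show "norm x / 2 \<le> norm (x + t *\<^sub>R h)" "norm (x + t *\<^sub>R h) \<le> 3 * (norm x / 2)"
    using norm_triangle_ineq[of x "t *\<^sub>R h"] norm_diff_ineq[of x "t *\<^sub>R h"] by simp_all
qed

text \<open>The acceptance ratio is only estimated for proposals whose segment to \<open>x\<close> stays between
  the radii \<open>\<parallel>x\<parallel> / 2\<close> and \<open>3 \<parallel>x\<parallel> / 2\<close>, whence the factor \<open>3\<close> in the last assumption.\<close>

locale convex_tail_potential =
  fixes U :: "'a::euclidean_space \<Rightarrow> real" and gU :: "'a \<Rightarrow> 'a" and HU :: "'a \<Rightarrow> 'a \<Rightarrow> 'a"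
    and \<kappa> \<Lambda> :: "real \<Rightarrow> real" and L K A :: real
  assumes grad: "(U has_derivative (\<lambda>h. gU x \<bullet> h)) (at x)"
    and hess: "(gU has_derivative HU x) (at x)"
    and grad_zero: "gU 0 = 0"
    and hess_bound: "norm (HU x v) \<le> L * norm v"
    and K_nonneg: "0 \<le> K"
    and hess_ge: "K \<le> norm x \<Longrightarrow> \<kappa> (norm x) * (norm v)\<^sup>2 \<le> HU x v \<bullet> v"
    and hess_le: "K \<le> norm x \<Longrightarrow> HU x v \<bullet> v \<le> \<Lambda> (norm x) * (norm v)\<^sup>2"
    and curvature_pos: "0 \<le> r \<Longrightarrow> 0 < \<kappa> r"
    and curvature_antimono: "antimono_on {0..} \<kappa>" "antimono_on {0..} \<Lambda>"
    and curvature_growth: "filterlim (\<lambda>r. r * \<kappa> r) at_top at_top"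
    and curvature_ratio: "0 \<le> r \<Longrightarrow> (\<Lambda> r)\<^sup>2 \<le> A * \<kappa> (3 * r)"
begin

lemma U_continuous: "continuous_on S U"
  by (meson continuous_at_imp_continuous_on grad has_derivative_continuous)

lemma gU_continuous: "continuous_on S gU"
  by (meson continuous_at_imp_continuous_on hess has_derivative_continuous)

lemma norm_grad_le: "norm (gU x) \<le> L * norm x"
  using differentiable_bound[of UNIV gU HU L x 0] hess hess_bound
  by (simp add: grad_zero onorm_le)

lemma hess_ge_curvature:
  assumes "K \<le> norm x" "norm x \<le> r"
  shows "\<kappa> r * (norm v)\<^sup>2 \<le> HU x v \<bullet> v"
proof -
  have "\<kappa> r * (norm v)\<^sup>2 \<le> \<kappa> (norm x) * (norm v)\<^sup>2"
    using monotone_onD[OF curvature_antimono(1) _ _ assms(2)] order_trans[OF norm_ge_zero assms(2)]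
    by (intro mult_right_mono) auto
  then show ?thesis
    using hess_ge[OF assms(1)] by (rule order_trans)
qed

lemma psd_operator_hess:
  assumes "K \<le> norm x" "\<And>v. HU x v \<bullet> v \<le> M * (norm v)\<^sup>2"
  shows "psd_operator (HU x) M"
proof -
  interpret linear "HU x"
    using hess by (rule has_derivative_linear)
  have "0 \<le> HU x v \<bullet> v" for v
    using hess_ge_curvature[OF assms(1) order_refl, of v] curvature_pos[of "norm x"]
    by (meson mult_nonneg_nonneg norm_ge_zero order_less_imp_le order_trans zero_le_power2)
  then show ?thesis
    using assms(2) symmetric_second_derivative[OF grad hess] by unfold_locales
qed

lemma norm_hess_le:
  assumes "K \<le> norm x" "0 \<le> r" "r \<le> norm x"
  shows "norm (HU x v) \<le> \<Lambda> r * norm v"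
proof (rule psd_operator.norm_le[OF psd_operator_hess[OF assms(1)]])
  fix w :: 'a
  have "\<Lambda> (norm x) * (norm w)\<^sup>2 \<le> \<Lambda> r * (norm w)\<^sup>2"
    using assms monotone_onD[OF curvature_antimono(2), of r "norm x"]
    by (intro mult_right_mono) auto
  then show "HU x w \<bullet> w \<le> \<Lambda> r * (norm w)\<^sup>2"
    using hess_le[OF assms(1), of w] by linarith
qed

lemma norm_gradient_step_diff_le:
  assumes \<gamma>: "0 \<le> \<gamma>" "\<gamma> * L \<le> 1" and x: "K \<le> norm x" "x \<noteq> 0"
  shows "norm (gradient_step gU \<gamma> x - gradient_step gU \<gamma> ((K / norm x) *\<^sub>R x))
    \<le> (norm x - K) * (1 - \<gamma> * \<kappa> (norm x) / 2)"
proof -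
  define s where "s = K / norm x"
  have s: "0 \<le> s" "s \<le> 1" "s * norm x = K"
    using x K_nonneg by (simp_all add: s_def)
  have "norm (gradient_step gU \<gamma> (s *\<^sub>R x + (1 - s) *\<^sub>R x) - gradient_step gU \<gamma> (s *\<^sub>R x))
      \<le> norm ((1 - s) *\<^sub>R x) * (1 - \<gamma> * \<kappa> (norm x) / 2)"
  proof (rule differentiable_bound_segment[where G = UNIV])
    show "(gradient_step gU \<gamma> has_derivative (\<lambda>v. v - \<gamma> *\<^sub>R HU y v)) (at y)" for y
      unfolding gradient_step_def by (auto intro!: derivative_eq_intros hess)
  next
    fix t :: real assume t: "t \<in> {0..1}"
    define y where "y = s *\<^sub>R x + t *\<^sub>R (1 - s) *\<^sub>R x"
    have "y = (s + t * (1 - s)) *\<^sub>R x"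
      by (simp add: y_def algebra_simps)
    then have "norm y = (s + t * (1 - s)) * norm x"
      using s t by simp
    moreover have "s \<le> s + t * (1 - s)" "s + t * (1 - s) \<le> 1"
      using s t mult_right_mono[of t 1 "1 - s"] by auto
    ultimately have y: "K \<le> norm y" "norm y \<le> norm x"
      using s by (auto simp flip: s(3) intro: mult_right_mono mult_left_le_one_le)
    have "HU y v \<bullet> v \<le> L * (norm v)\<^sup>2" for v
      using norm_cauchy_schwarz[of "HU y v" v] mult_right_mono[OF hess_bound, of "norm v" y v]
      by (simp add: power2_eq_square)
    then interpret psd_operator "HU y" L
      by (rule psd_operator_hess[OF y(1)])
    show "onorm (\<lambda>v. v - \<gamma> *\<^sub>R HU (s *\<^sub>R x + t *\<^sub>R (1 - s) *\<^sub>R x) v) \<le> 1 - \<gamma> * \<kappa> (norm x) / 2"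
      unfolding y_def[symmetric] using hess_ge_curvature[OF y]
      by (intro onorm_le norm_diff_scaled_le \<gamma>)
  qed auto
  moreover have "norm ((1 - s) *\<^sub>R x) = norm x - K"
    using s by (simp add: left_diff_distrib)
  ultimately show ?thesis
    by (simp add: s_def flip: scaleR_left_distrib)
qed

lemma norm_gradient_step_le:
  assumes \<gamma>: "0 \<le> \<gamma>" "\<gamma> * L \<le> 1" and x: "K \<le> norm x" "x \<noteq> 0"
  shows "norm (gradient_step gU \<gamma> x) \<le> norm x - \<gamma> * ((norm x - K) * \<kappa> (norm x) / 2 - L * K)"
proof -
  define x0 where "x0 = (K / norm x) *\<^sub>R x"
  have "norm x0 = K"
    using x K_nonneg by (simp add: x0_def)
  then have "norm (gradient_step gU \<gamma> x0) \<le> K + \<gamma> * (L * K)"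
    using norm_triangle_ineq4[of x0 "\<gamma> *\<^sub>R gU x0"] mult_left_mono[OF norm_grad_le \<gamma>(1), of x0] \<gamma>(1)
    by (simp add: gradient_step_def)
  moreover have "norm (gradient_step gU \<gamma> x)
      \<le> norm (gradient_step gU \<gamma> x - gradient_step gU \<gamma> x0) + norm (gradient_step gU \<gamma> x0)"
    using norm_triangle_sub by (simp add: add.commute)
  ultimately show ?thesis
    using norm_gradient_step_diff_le[OF assms] by (simp add: x0_def field_simps)
qed

lemma gradient_step_gain:
  assumes \<gamma>: "0 < \<gamma>" "\<gamma> * L \<le> 1"
  shows "filterlim (\<lambda>x. norm x - norm (gradient_step gU \<gamma> x)) at_top at_infinity"
proof (rule filterlim_at_top_mono)
  have "filterlim (\<lambda>r. \<gamma> * (- (L * K) + 1/4 * (r * \<kappa> r))) at_top at_top"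
    using \<gamma> curvature_growth
    by (intro filterlim_tendsto_add_at_top[OF tendsto_const]
        filterlim_tendsto_pos_mult_at_top[OF tendsto_const]) auto
  then show "filterlim (\<lambda>x :: 'a. \<gamma> * (- (L * K) + 1/4 * (norm x * \<kappa> (norm x)))) at_top at_infinity"
    by (rule filterlim_compose[OF _ filterlim_norm_at_top])
next
  have "\<forall>\<^sub>F x :: 'a in at_infinity. 2 * K + 1 \<le> norm x"
    by (auto simp: eventually_at_infinity)
  then show "\<forall>\<^sub>F x in at_infinity.
      \<gamma> * (- (L * K) + 1/4 * (norm x * \<kappa> (norm x))) \<le> norm x - norm (gradient_step gU \<gamma> x)"
  proof eventually_elim
    case (elim x)
    have "norm x / 2 * \<kappa> (norm x) \<le> (norm x - K) * \<kappa> (norm x)"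
      using elim curvature_pos[of "norm x"] by (intro mult_right_mono) auto
    then have "\<gamma> * (- (L * K) + 1/4 * (norm x * \<kappa> (norm x)))
        \<le> \<gamma> * ((norm x - K) * \<kappa> (norm x) / 2 - L * K)"
      using \<gamma> by (intro mult_left_mono) auto
    moreover have "norm (gradient_step gU \<gamma> x)
        \<le> norm x - \<gamma> * ((norm x - K) * \<kappa> (norm x) / 2 - L * K)"
      using elim K_nonneg \<gamma> by (intro norm_gradient_step_le) auto
    ultimately show ?case
      by linarith
  qed
qed

lemma eventually_radial_gradient_ge: "\<forall>\<^sub>F x in at_infinity. B * norm x \<le> gU x \<bullet> x"
proof -
  define \<gamma> where "\<gamma> = 1 / (\<bar>L\<bar> + 1)"
  have \<gamma>: "0 < \<gamma>" "\<gamma> * L \<le> 1"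
    by (auto simp: \<gamma>_def field_simps)
  have "\<forall>\<^sub>F x in at_infinity. \<gamma> * B \<le> norm x - norm (gradient_step gU \<gamma> x)"
    using gradient_step_gain[OF \<gamma>] by (simp add: filterlim_at_top)
  then show ?thesis
  proof eventually_elim
    case (elim x)
    have "gradient_step gU \<gamma> x \<bullet> x \<le> norm (gradient_step gU \<gamma> x) * norm x"
      by (rule norm_cauchy_schwarz)
    also have "\<dots> \<le> (norm x - \<gamma> * B) * norm x"
      using elim by (intro mult_right_mono) auto
    finally have "\<gamma> * (B * norm x) \<le> \<gamma> * (gU x \<bullet> x)"
      by (simp add: gradient_step_def inner_simps power2_norm_eq_inner[symmetric]
          power2_eq_square algebra_simps)
    then show ?case
      using \<gamma> by simp
  qed
qed

lemma U_ge_along_ray: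
  assumes R: "0 < R" "\<And>x. R \<le> norm x \<Longrightarrow> B * norm x \<le> gU x \<bullet> x" and x: "R < norm x"
  shows "U (R *\<^sub>R sgn x) + (norm x - R) * B \<le> U x"
proof -
  define e where "e = sgn x"
  have "x \<noteq> 0"
    using R x by auto
  then have e: "norm e = 1" "x = norm x *\<^sub>R e"
    by (simp_all add: e_def norm_sgn sgn_div_norm)
  have "((\<lambda>s. U (0 + s *\<^sub>R e)) has_real_derivative gU (0 + s *\<^sub>R e) \<bullet> e) (at s)" for s
    by (rule has_real_derivative_along_line[OF grad])
  then obtain s where s: "R < s" "s < norm x"
    "U (0 + norm x *\<^sub>R e) - U (0 + R *\<^sub>R e) = (norm x - R) * (gU (0 + s *\<^sub>R e) \<bullet> e)"
    using MVT2[OF x, of "\<lambda>s. U (0 + s *\<^sub>R e)" "\<lambda>s. gU (0 + s *\<^sub>R e) \<bullet> e"] by blast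
  have "B \<le> gU (s *\<^sub>R e) \<bullet> e"
    using R(2)[of "s *\<^sub>R e"] s(1) R(1) e(1) by simp
  then have "(norm x - R) * B \<le> (norm x - R) * (gU (s *\<^sub>R e) \<bullet> e)"
    using x by (intro mult_left_mono) auto
  also have "\<dots> = U x - U (R *\<^sub>R e)"
    using s(3) e(2) by simp
  finally show ?thesis
    by (simp add: e_def)
qed

lemma U_superlinear: "\<exists>C. \<forall>x. B * norm x - C \<le> U x"
proof -
  obtain R where R: "0 < R" "\<And>x. R \<le> norm x \<Longrightarrow> B * norm x \<le> gU x \<bullet> x"
    using eventually_radial_gradient_ge[of B] by (auto simp: eventually_at_infinity_pos)
  have "bdd_below (U ` cball 0 R)"
    by (intro bounded_imp_bdd_below compact_imp_bounded compact_continuous_image U_continuous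
        compact_cball)
  then obtain D where D: "\<And>x. norm x \<le> R \<Longrightarrow> D \<le> U x"
    by (fastforce simp: bdd_below_def)
  have "B * norm x - (\<bar>B\<bar> * R - D) \<le> U x" for x
  proof (cases "norm x \<le> R")
    case True
    then have "B * norm x \<le> \<bar>B\<bar> * R"
      by (intro mult_mono) auto
    then show ?thesis
      using D[OF True] by simp
  next
    case False
    have "D + (norm x - R) * B \<le> U (R *\<^sub>R sgn x) + (norm x - R) * B"
      using R(1) by (intro add_right_mono D) (simp add: norm_sgn)
    also have "\<dots> \<le> U x"
      using False by (intro U_ge_along_ray R) simp_all
    finally have "D + (norm x - R) * B \<le> U x" .
    moreover have "B * R \<le> \<bar>B\<bar> * R"
      using R by (intro mult_right_mono) auto
    ultimately show ?thesis
      by (simp add: algebra_simps)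
  qed
  then show ?thesis by blast
qed

lemma norm_gradient_diff_le:
  assumes "2 * norm (y - x) \<le> norm x" and far: "2 * K \<le> norm x"
  shows "norm (gU y - gU x) \<le> \<Lambda> (norm x / 2) * norm (y - x)"
proof -
  have "norm (gU (x + (y - x)) - gU x) \<le> norm (y - x) * \<Lambda> (norm x / 2)"
  proof (rule differentiable_bound_segment[where G = UNIV and f' = HU])
    show "onorm (HU (x + t *\<^sub>R (y - x))) \<le> \<Lambda> (norm x / 2)" if "t \<in> {0..1}" for t
      using norm_segment_bounds(1)[OF assms(1), of t] that far
      by (intro onorm_le norm_hess_le) auto
  qed (auto intro: hess)
  then show ?thesis
    by (simp add: mult.commute)
qed

lemma taylor_remainder_ge:
  assumes "2 * norm (y - x) \<le> norm x" and far: "2 * K \<le> norm x"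
  shows "\<kappa> (3 * (norm x / 2)) * (norm (y - x))\<^sup>2 \<le> 2 * (U x - U y + gU y \<bullet> (y - x))"
proof -
  define c where "c = \<kappa> (3 * (norm x / 2))"
  have "U y + gU y \<bullet> (x - y) + c / 2 * (norm (x - y))\<^sup>2 \<le> U (y + (x - y))"
  proof (rule taylor_lower_bound[OF grad hess])
    fix t :: real assume "0 < t" "t < 1"
    then have "norm x / 2 \<le> norm (x + (1 - t) *\<^sub>R (y - x))"
      "norm (x + (1 - t) *\<^sub>R (y - x)) \<le> 3 * (norm x / 2)"
      by (intro norm_segment_bounds[OF assms(1)]; simp)+
    moreover have "y + t *\<^sub>R (x - y) = x + (1 - t) *\<^sub>R (y - x)"
      by (simp add: algebra_simps)
    ultimately show "c * (norm (x - y))\<^sup>2 \<le> HU (y + t *\<^sub>R (x - y)) (x - y) \<bullet> (x - y)"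
      unfolding c_def using far by (intro hess_ge_curvature) auto
  qed
  then show ?thesis
    by (simp add: c_def norm_minus_commute inner_diff_right)
qed

lemma gradient_diff_sq_le_taylor_remainder:
  assumes \<gamma>: "0 \<le> \<gamma>" "\<gamma> * A \<le> 1"
    and near: "2 * norm (y - x) \<le> norm x" and far: "2 * K \<le> norm x"
  shows "\<gamma> * (norm (gU y - gU x))\<^sup>2 \<le> 2 * (U x - U y + gU y \<bullet> (y - x))"
proof -
  define u where "u = norm x / 2"
  define n where "n = (norm (y - x))\<^sup>2"
  have "(norm (gU y - gU x))\<^sup>2 \<le> (\<Lambda> u * norm (y - x))\<^sup>2"
    unfolding u_def by (intro power_mono norm_gradient_diff_le near far) simp
  then have "\<gamma> * (norm (gU y - gU x))\<^sup>2 \<le> \<gamma> * ((\<Lambda> u)\<^sup>2 * n)"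
    using \<gamma> by (intro mult_left_mono) (auto simp: power_mult_distrib n_def)
  also have "\<dots> \<le> \<gamma> * (A * \<kappa> (3 * u) * n)"
    using \<gamma> by (intro mult_left_mono mult_right_mono curvature_ratio) (auto simp: u_def n_def)
  also have "\<dots> = (\<gamma> * A) * (\<kappa> (3 * u) * n)"
    by simp
  also have "\<dots> \<le> 1 * (\<kappa> (3 * u) * n)"
    using \<gamma> curvature_pos[of "3 * u"] by (intro mult_right_mono) (auto simp: u_def n_def)
  also have "\<dots> \<le> 2 * (U x - U y + gU y \<bullet> (y - x))"
    unfolding u_def n_def using taylor_remainder_ge[OF near far] by simp
  finally show ?thesis .
qed

lemma norm_proposal_diff_le:
  assumes \<gamma>: "0 \<le> \<gamma>" "\<gamma> * L \<le> 1/4"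
    and y: "norm (y - gradient_step gU \<gamma> x) \<le> norm x / 4"
  shows "2 * norm (y - x) \<le> norm x"
proof -
  have "norm (\<gamma> *\<^sub>R gU x) \<le> (\<gamma> * L) * norm x"
    using mult_left_mono[OF norm_grad_le \<gamma>(1), of x] \<gamma>(1) by simp
  also have "\<dots> \<le> 1/4 * norm x"
    using \<gamma>(2) by (intro mult_right_mono) auto
  finally have "norm (\<gamma> *\<^sub>R gU x) \<le> norm x / 4"
    by simp
  moreover have "norm (y - x) = norm ((y - gradient_step gU \<gamma> x) - \<gamma> *\<^sub>R gU x)"
    by (simp add: gradient_step_def)
  then have "norm (y - x) \<le> norm (y - gradient_step gU \<gamma> x) + norm (\<gamma> *\<^sub>R gU x)"
    using norm_triangle_ineq4 by (rule ord_eq_le_trans)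
  ultimately show ?thesis
    using y by linarith
qed

end

section \<open>Harris' theorem\<close>

lemma has_bochner_integral_bind_nonneg:
  fixes f :: "'b \<Rightarrow> real"
  assumes K: "K \<in> M \<rightarrow>\<^sub>M subprob_algebra N" and f: "f \<in> borel_measurable N" "\<And>x. 0 \<le> f x"
    and int: "integrable (M \<bind> K) f" "\<And>x. x \<in> space M \<Longrightarrow> integrable (K x) f"
  shows "has_bochner_integral M (\<lambda>x. \<integral>y. f y \<partial>K x) (\<integral>y. f y \<partial>(M \<bind> K))"
proof (rule has_bochner_integral_nn_integral)
  have "(\<integral>\<^sup>+x. ennreal (\<integral>y. f y \<partial>K x) \<partial>M) = (\<integral>\<^sup>+x. \<integral>\<^sup>+y. ennreal (f y) \<partial>K x \<partial>M)"
    using int(2) f(2) by (intro nn_integral_cong) (simp add: nn_integral_eq_integral)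
  also have "\<dots> = (\<integral>\<^sup>+y. ennreal (f y) \<partial>(M \<bind> K))"
    using f(1) by (intro nn_integral_bind[OF _ K, symmetric]) simp
  also have "\<dots> = ennreal (\<integral>y. f y \<partial>(M \<bind> K))"
    using int(1) f(2) by (intro nn_integral_eq_integral) auto
  finally show "(\<integral>\<^sup>+x. ennreal (\<integral>y. f y \<partial>K x) \<partial>M) = ennreal (\<integral>y. f y \<partial>(M \<bind> K))" .
  show "(\<lambda>x. \<integral>y. f y \<partial>K x) \<in> borel_measurable M"
    using K f(1) by measurable
qed (use f(2) in \<open>auto simp: integral_nonneg_AE\<close>)

lemma has_bochner_integral_bind:
  fixes f :: "'b \<Rightarrow> real"
  assumes K: "K \<in> M \<rightarrow>\<^sub>M subprob_algebra N" and f: "f \<in> borel_measurable N"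
    and int: "integrable (M \<bind> K) f" "\<And>x. x \<in> space M \<Longrightarrow> integrable (K x) f"
  shows "has_bochner_integral M (\<lambda>x. \<integral>y. f y \<partial>K x) (\<integral>y. f y \<partial>(M \<bind> K))"
proof -
  define p where "p x = max 0 (f x)" for x
  define n where "n x = max 0 (- f x)" for x
  have parts: "p \<in> borel_measurable N" "n \<in> borel_measurable N" "0 \<le> p x" "0 \<le> n x"
    "f = (\<lambda>x. p x - n x)" for x
    using f by (auto simp: p_def[abs_def] n_def[abs_def])
  have int_parts: "integrable Q p" "integrable Q n" if "integrable Q f" for Q
    unfolding p_def n_def using that by (auto intro: integrable_max)
  have "has_bochner_integral M (\<lambda>x. (\<integral>y. p y \<partial>K x) - (\<integral>y. n y \<partial>K x))
      ((\<integral>y. p y \<partial>(M \<bind> K)) - (\<integral>y. n y \<partial>(M \<bind> K)))"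
    using parts int
    by (intro has_bochner_integral_diff has_bochner_integral_bind_nonneg[OF K] int_parts)
  moreover have "(\<integral>y. p y \<partial>K x) - (\<integral>y. n y \<partial>K x) = (\<integral>y. f y \<partial>K x)" if "x \<in> space M" for x
    unfolding parts(5) using int(2)[OF that]
    by (intro Bochner_Integration.integral_diff[symmetric] int_parts)
  moreover have "(\<integral>y. p y \<partial>(M \<bind> K)) - (\<integral>y. n y \<partial>(M \<bind> K)) = (\<integral>y. f y \<partial>(M \<bind> K))"
    unfolding parts(5) using int(1)
    by (intro Bochner_Integration.integral_diff[symmetric] int_parts)
  ultimately show ?thesis
    by (simp cong: has_bochner_integral_cong)
qed

lemma
  fixes f :: "'a \<Rightarrow> real"
  assumes le: "scale_measure (ennreal \<epsilon>) N \<le> M" and sets: "sets N = sets M"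
    and f: "integrable M f" "\<And>x. x \<in> space M \<Longrightarrow> 0 \<le> f x"
  shows integrable_of_scale_measure_le: "0 < \<epsilon> \<Longrightarrow> integrable N f"
    and integral_scale_measure_le: "0 \<le> \<epsilon> \<Longrightarrow> \<epsilon> * (\<integral>x. f x \<partial>N) \<le> (\<integral>x. f x \<partial>M)"
proof -
  have [measurable]: "f \<in> borel_measurable N"
    using f(1) by (simp add: measurable_cong_sets[OF sets refl])
  have nonneg: "AE x in N. 0 \<le> f x"
    using f(2) sets_eq_imp_space_eq[OF sets] by (intro AE_I2) simp
  have "ennreal \<epsilon> * (\<integral>\<^sup>+x. ennreal (f x) \<partial>N) = (\<integral>\<^sup>+x. ennreal (f x) \<partial>scale_measure (ennreal \<epsilon>) N)"
    by (simp add: nn_integral_scale_measure)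
  also have "\<dots> \<le> (\<integral>\<^sup>+x. ennreal (f x) \<partial>M)"
    using le sets by (intro nn_integral_mono_measure) auto
  also have "\<dots> = ennreal (\<integral>x. f x \<partial>M)"
    using f by (intro nn_integral_eq_integral) auto
  finally have bound: "ennreal \<epsilon> * (\<integral>\<^sup>+x. ennreal (f x) \<partial>N) \<le> ennreal (\<integral>x. f x \<partial>M)" .
  show int: "integrable N f" if "0 < \<epsilon>"
  proof (rule integrableI_nonneg)
    show "(\<integral>\<^sup>+x. ennreal (f x) \<partial>N) < \<infinity>"
      using bound that by (auto simp: less_top[symmetric] ennreal_mult_top top_unique)
  qed (use nonneg in auto)
  show "\<epsilon> * (\<integral>x. f x \<partial>N) \<le> (\<integral>x. f x \<partial>M)" if "0 \<le> \<epsilon>"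
  proof (cases "\<epsilon> = 0")
    case False
    then show ?thesis
      using int bound nonneg f(2) that
      by (simp add: nn_integral_eq_integral ennreal_mult[symmetric] integral_nonneg_AE)
  qed (use f(2) in \<open>simp add: integral_nonneg_AE\<close>)
qed

primrec kernel_iter :: "'a measure \<Rightarrow> ('a \<Rightarrow> 'a measure) \<Rightarrow> nat \<Rightarrow> 'a \<Rightarrow> 'a measure" where
  "kernel_iter M P 0 x = return M x"
| "kernel_iter M P (Suc k) x = kernel_iter M P k x \<bind> P"

locale drift_kernel =
  fixes M :: "'a measure" and P :: "'a \<Rightarrow> 'a measure" and V :: "'a \<Rightarrow> real" and \<alpha> b :: real
  assumes kernel[measurable]: "P \<in> M \<rightarrow>\<^sub>M prob_algebra M"
    and V_measurable[measurable]: "V \<in> borel_measurable M"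
    and V_ge_1: "1 \<le> V x"
    and rate: "0 \<le> \<alpha>" "\<alpha> < 1" and b_nonneg: "0 \<le> b"
    and drift: "x \<in> space M \<Longrightarrow> (\<integral>\<^sup>+y. ennreal (V y) \<partial>P x) \<le> ennreal (\<alpha> * V x + b)"
begin

definition admissible :: "'a measure \<Rightarrow> bool" where
  "admissible N \<longleftrightarrow> prob_space N \<and> sets N = sets M \<and> integrable N V"

definition V_bounded :: "('a \<Rightarrow> real) \<Rightarrow> bool" where
  "V_bounded f \<longleftrightarrow> f \<in> borel_measurable M \<and> (\<exists>c. \<forall>x\<in>space M. \<bar>f x\<bar> \<le> c * V x)"

lemma V_nonneg: "0 \<le> V x"
  using V_ge_1[of x] by simp

lemma kernel_subprob: "P \<in> M \<rightarrow>\<^sub>M subprob_algebra M"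
  by (rule measurable_prob_algebraD[OF kernel])

lemma admissible_space: "admissible N \<Longrightarrow> space N = space M"
  by (auto simp: admissible_def dest: sets_eq_imp_space_eq)

lemma admissible_kernel: "admissible N \<Longrightarrow> P \<in> N \<rightarrow>\<^sub>M subprob_algebra M"
  using kernel_subprob by (simp add: admissible_def cong: measurable_cong_sets)

lemma admissible_P: "x \<in> space M \<Longrightarrow> admissible (P x)"
proof -
  assume x: "x \<in> space M"
  have P: "prob_space (P x)" "sets (P x) = sets M"
    using measurable_space[OF kernel x] by (auto simp: space_prob_algebra)
  then have "V \<in> borel_measurable (P x)"
    by (simp cong: measurable_cong_sets)
  then have "integrable (P x) V"
    using drift[OF x] V_nonneg by (intro integrableI_nonneg) (auto intro: order_le_less_trans)
  with P show ?thesis by (simp add: admissible_def)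
qed

lemma admissible_return: "x \<in> space M \<Longrightarrow> admissible (return M x)"
  using V_nonneg
  by (auto simp: admissible_def prob_space_return nn_integral_return intro!: integrableI_nonneg)

lemma V_bounded_V: "V_bounded V"
  using V_nonneg by (auto simp: V_bounded_def intro!: exI[of _ 1])

lemma integrable_V_bounded:
  assumes "admissible N" "V_bounded f"
  shows "integrable N f"
proof -
  obtain c where c: "\<And>x. x \<in> space M \<Longrightarrow> \<bar>f x\<bar> \<le> c * V x"
    using assms(2) by (auto simp: V_bounded_def)
  have "f \<in> borel_measurable N"
    using assms by (simp add: admissible_def V_bounded_def cong: measurable_cong_sets)
  moreover have "integrable N (\<lambda>x. c * V x)"
    using assms(1) by (simp add: admissible_def)
  ultimately show ?thesis
    using c admissible_space[OF assms(1)]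
    by (intro Bochner_Integration.integrable_bound[of N "\<lambda>x. c * V x" f])
      (auto intro!: AE_I2 order_trans[OF c])
qed

lemma integral_P_V_le:
  assumes x: "x \<in> space M"
  shows "(\<integral>y. V y \<partial>P x) \<le> \<alpha> * V x + b"
proof -
  have "ennreal (\<integral>y. V y \<partial>P x) \<le> ennreal (\<alpha> * V x + b)"
    using drift[OF x] integrable_V_bounded[OF admissible_P[OF x] V_bounded_V] V_nonneg
    by (simp add: nn_integral_eq_integral)
  then show ?thesis
    using V_nonneg[of x] rate b_nonneg by (subst (asm) ennreal_le_iff) auto
qed

lemma V_bounded_P:
  assumes "V_bounded f"
  shows "V_bounded (\<lambda>x. \<integral>y. f y \<partial>P x)"
proof -
  obtain c where c: "\<And>x. x \<in> space M \<Longrightarrow> \<bar>f x\<bar> \<le> c * V x"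
    using assms by (auto simp: V_bounded_def)
  have [measurable]: "f \<in> borel_measurable M"
    using assms by (simp add: V_bounded_def)
  have "\<bar>\<integral>y. f y \<partial>P x\<bar> \<le> \<bar>c\<bar> * (\<alpha> + b) * V x" if x: "x \<in> space M" for x
  proof -
    have "\<bar>f y\<bar> \<le> \<bar>c\<bar> * V y" if "y \<in> space M" for y
      using c[OF that] mult_right_mono[OF abs_ge_self[of c] V_nonneg[of y]] by linarith
    then have "\<bar>\<integral>y. f y \<partial>P x\<bar> \<le> (\<integral>y. \<bar>c\<bar> * V y \<partial>P x)"
      using integrable_V_bounded[OF admissible_P[OF x]] assms V_bounded_V
        admissible_space[OF admissible_P[OF x]]
      by (intro order_trans[OF integral_abs_bound] integral_mono) auto
    also have "\<dots> \<le> \<bar>c\<bar> * (\<alpha> * V x + b)"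
      using integral_P_V_le[OF x] by (simp add: mult_left_mono)
    also have "\<dots> \<le> \<bar>c\<bar> * (\<alpha> * V x + b * V x)"
      using b_nonneg V_ge_1[of x] mult_left_mono[of 1 "V x" b] by (intro mult_left_mono) auto
    finally show ?thesis by (simp add: algebra_simps)
  qed
  moreover have "(\<lambda>x. \<integral>y. f y \<partial>P x) \<in> borel_measurable M"
    using kernel_subprob by measurable
  ultimately show ?thesis by (auto simp: V_bounded_def)
qed

lemma admissible_bind:
  assumes N: "admissible N"
  shows "admissible (N \<bind> P)"
proof -
  interpret prob_space N
    using N by (simp add: admissible_def)
  have space: "space N = space M"
    using N by (rule admissible_space)
  have sets: "sets (N \<bind> P) = sets M"
    using admissible_P not_empty space by (intro sets_bind) (auto simp: admissible_def)
  have "prob_space (N \<bind> P)"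
    using admissible_P space admissible_kernel[OF N]
    by (intro prob_space_bind) (auto simp: admissible_def)
  moreover have "integrable (N \<bind> P) V"
  proof (rule integrableI_nonneg)
    have "(\<integral>\<^sup>+x. ennreal (V x) \<partial>(N \<bind> P)) = (\<integral>\<^sup>+x. \<integral>\<^sup>+y. ennreal (V y) \<partial>P x \<partial>N)"
      by (rule nn_integral_bind[OF _ admissible_kernel[OF N]]) measurable
    also have "\<dots> \<le> (\<integral>\<^sup>+x. ennreal (\<alpha> * V x + b) \<partial>N)"
      using space by (intro nn_integral_mono drift) simp
    also have "\<dots> = ennreal (\<integral>x. \<alpha> * V x + b \<partial>N)"
      using N V_nonneg rate b_nonneg by (intro nn_integral_eq_integral) (auto simp: admissible_def)
    finally show "(\<integral>\<^sup>+x. ennreal (V x) \<partial>(N \<bind> P)) < \<infinity>"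
      by (rule order_le_less_trans) simp
  qed (use V_nonneg sets in \<open>auto cong: measurable_cong_sets\<close>)
  ultimately show ?thesis
    using sets by (simp add: admissible_def)
qed

lemma admissible_iter: "x \<in> space M \<Longrightarrow> admissible (kernel_iter M P k x)"
  by (induction k) (auto intro: admissible_return admissible_bind)

lemma integral_bind_V_bounded:
  assumes N: "admissible N" and f: "V_bounded f"
  shows "(\<integral>x. f x \<partial>(N \<bind> P)) = (\<integral>x. (\<integral>y. f y \<partial>P x) \<partial>N)"
  using f admissible_space[OF N]
  by (intro has_bochner_integral_integral_eq[symmetric]
      has_bochner_integral_bind[OF admissible_kernel[OF N]] integrable_V_bounded[OF _ f]
      admissible_bind admissible_P N)
    (auto simp: V_bounded_def)

lemma integral_iter_invariant:
  assumes N: "admissible N" "N \<bind> P = N" and f: "V_bounded f"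
  shows "(\<integral>x. (\<integral>y. f y \<partial>kernel_iter M P k x) \<partial>N) = (\<integral>x. f x \<partial>N)"
  using f
proof (induction k arbitrary: f)
  case 0
  then show ?case
    using admissible_space[OF N(1)]
    by (intro Bochner_Integration.integral_cong) (auto simp: integral_return V_bounded_def)
next
  case (Suc k)
  have "(\<integral>x. (\<integral>y. f y \<partial>kernel_iter M P (Suc k) x) \<partial>N)
      = (\<integral>x. (\<integral>y. (\<integral>z. f z \<partial>P y) \<partial>kernel_iter M P k x) \<partial>N)"
    using admissible_space[OF N(1)] integral_bind_V_bounded[OF admissible_iter Suc.prems]
    by (subst Bochner_Integration.integral_cong[OF refl, of N]) simp_all
  also have "\<dots> = (\<integral>x. (\<integral>z. f z \<partial>P x) \<partial>N)"
    by (intro Suc.IH V_bounded_P Suc.prems)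
  also have "\<dots> = (\<integral>x. f x \<partial>N)"
    using integral_bind_V_bounded[OF N(1) Suc.prems] N(2) by simp
  finally show ?case .
qed

definition osc_le :: "real \<Rightarrow> real \<Rightarrow> ('a \<Rightarrow> real) \<Rightarrow> bool" where
  "osc_le \<theta> c f \<longleftrightarrow> V_bounded f \<and>
     (\<forall>x\<in>space M. \<forall>y\<in>space M. f x - f y \<le> c * (2 + \<theta> * V x + \<theta> * V y))"

lemma osc_le_imp_centred_bound:
  assumes "osc_le \<theta> c f"
  obtains a where "\<And>x. x \<in> space M \<Longrightarrow> \<bar>f x - a\<bar> \<le> c * (1 + \<theta> * V x)"
proof (cases "space M = {}")
  case False
  define l where "l x = f x - c * (1 + \<theta> * V x)" for x
  have le: "l x \<le> f y + c * (1 + \<theta> * V y)" if "x \<in> space M" "y \<in> space M" for x y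
    using assms that by (fastforce simp: osc_le_def l_def algebra_simps)
  have "l x \<le> (SUP x\<in>space M. l x)" if "x \<in> space M" for x
    using le that by (intro cSUP_upper bdd_aboveI2[where M = "f x + c * (1 + \<theta> * V x)"]) auto
  moreover have "(SUP x\<in>space M. l x) \<le> f y + c * (1 + \<theta> * V y)" if "y \<in> space M" for y
    using le that False by (intro cSUP_least) auto
  ultimately show thesis
    by (intro that[of "SUP x\<in>space M. l x"]) (fastforce simp: l_def abs_le_iff)
qed (use that in simp)

text \<open>With \<open>g = c (1 + \<theta> V)\<close> and a centre \<open>a\<close> such that \<open>\<bar>f - a\<bar> \<le> g\<close>, minorization applied to the
  nonnegative functions \<open>g \<plusminus> (f - a)\<close> gains \<open>2 \<epsilon> \<integral> g d\<nu> \<ge> 2 \<epsilon> c\<close>.\<close>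

lemma osc_le_integral_diff:
  assumes f: "osc_le \<theta> c f" and c: "0 \<le> c" and \<theta>: "0 \<le> \<theta>"
    and X: "admissible X" and Y: "admissible Y"
    and \<nu>: "admissible \<nu>" and "0 \<le> \<epsilon>"
    and minor: "scale_measure (ennreal \<epsilon>) \<nu> \<le> X" "scale_measure (ennreal \<epsilon>) \<nu> \<le> Y"
  shows "(\<integral>u. f u \<partial>X) - (\<integral>u. f u \<partial>Y)
    \<le> c * (2 * (1 - \<epsilon>) + \<theta> * (\<integral>u. V u \<partial>X) + \<theta> * (\<integral>u. V u \<partial>Y))"
proof -
  obtain a where a: "\<And>x. x \<in> space M \<Longrightarrow> \<bar>f x - a\<bar> \<le> c * (1 + \<theta> * V x)"
    using osc_le_imp_centred_bound[OF f] by blast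
  have "V_bounded f"
    using f by (simp add: osc_le_def)
  note int = integrable_V_bounded[OF _ this] integrable_V_bounded[OF _ V_bounded_V]
  have integral: "integrable Z (\<lambda>x. c * (1 + \<theta> * V x) + s * (f x - a))"
      "(\<integral>x. c * (1 + \<theta> * V x) + s * (f x - a) \<partial>Z)
        = c * (1 + \<theta> * (\<integral>x. V x \<partial>Z)) + s * ((\<integral>x. f x \<partial>Z) - a)"
    if Z: "admissible Z" for Z s
  proof -
    interpret Z: prob_space Z
      using Z by (simp add: admissible_def)
    show "integrable Z (\<lambda>x. c * (1 + \<theta> * V x) + s * (f x - a))"
      using int Z by simp
    show "(\<integral>x. c * (1 + \<theta> * V x) + s * (f x - a) \<partial>Z)
        = c * (1 + \<theta> * (\<integral>x. V x \<partial>Z)) + s * ((\<integral>x. f x \<partial>Z) - a)"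
      using int Z by (simp add: Z.prob_space)
  qed
  have minor_integral: "\<epsilon> * (c * (1 + \<theta> * (\<integral>x. V x \<partial>\<nu>)) + s * ((\<integral>x. f x \<partial>\<nu>) - a))
      \<le> c * (1 + \<theta> * (\<integral>x. V x \<partial>Z)) + s * ((\<integral>x. f x \<partial>Z) - a)"
    if Z: "admissible Z" "scale_measure (ennreal \<epsilon>) \<nu> \<le> Z" and s: "\<bar>s\<bar> = 1" for Z s
  proof -
    have "0 \<le> c * (1 + \<theta> * V x) + s * (f x - a)" if "x \<in> space Z" for x
      using a[of x] that s admissible_space[OF Z(1)] by (auto simp: abs_if split: if_splits)
    then show ?thesis
      using integral_scale_measure_le[OF Z(2) _ integral(1)[OF Z(1), of s]] Z \<nu> \<open>0 \<le> \<epsilon>\<close>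
      by (simp add: integral(2)[OF \<nu>] integral(2)[OF Z(1)] admissible_def)
  qed
  have "0 \<le> (\<integral>x. V x \<partial>\<nu>)"
    using V_nonneg by (simp add: integral_nonneg_AE)
  then have "\<epsilon> * c * 1 \<le> \<epsilon> * c * (1 + \<theta> * (\<integral>x. V x \<partial>\<nu>))"
    using \<open>0 \<le> \<epsilon>\<close> c \<theta> by (intro mult_left_mono) auto
  then show ?thesis
    using minor_integral[OF X minor(1), of "-1"] minor_integral[OF Y minor(2), of 1]
    by (simp add: algebra_simps)
qed

lemma integral_P_diff_le:
  assumes f: "osc_le \<theta> c f" and c: "0 \<le> c" and \<theta>: "0 \<le> \<theta>" and x: "x \<in> space M" "y \<in> space M"
    and \<nu>: "admissible \<nu>" "0 \<le> \<epsilon>"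
    and minor: "scale_measure (ennreal \<epsilon>) \<nu> \<le> P x" "scale_measure (ennreal \<epsilon>) \<nu> \<le> P y"
  shows "(\<integral>u. f u \<partial>P x) - (\<integral>u. f u \<partial>P y) \<le> c * (2 * (1 - \<epsilon>) + 2 * \<theta> * b + \<theta> * \<alpha> * (V x + V y))"
proof -
  have "(\<integral>u. f u \<partial>P x) - (\<integral>u. f u \<partial>P y)
      \<le> c * (2 * (1 - \<epsilon>) + \<theta> * (\<integral>u. V u \<partial>P x) + \<theta> * (\<integral>u. V u \<partial>P y))"
    by (intro osc_le_integral_diff[OF f c \<theta> _ _ \<nu>] admissible_P x minor)
  also have "\<dots> \<le> c * (2 * (1 - \<epsilon>) + \<theta> * (\<alpha> * V x + b) + \<theta> * (\<alpha> * V y + b))"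
    by (intro mult_left_mono add_mono integral_P_V_le x \<theta> c order_refl)
  finally show ?thesis
    by (simp add: algebra_simps)
qed

lemma integral_P_diff_le_small_set:
  assumes f: "osc_le \<theta> c f" and c: "0 \<le> c" and \<theta>: "0 \<le> \<theta>" and x: "x \<in> space M" "y \<in> space M"
    and \<nu>: "prob_space \<nu>" "sets \<nu> = sets M" and \<epsilon>: "0 < \<epsilon>"
    and minor: "scale_measure (ennreal \<epsilon>) \<nu> \<le> P x" "scale_measure (ennreal \<epsilon>) \<nu> \<le> P y"
  shows "(\<integral>u. f u \<partial>P x) - (\<integral>u. f u \<partial>P y) \<le> c * (2 * (1 - \<epsilon>) + 2 * \<theta> * b + \<theta> * \<alpha> * (V x + V y))"
proof -
  have "integrable \<nu> V"
    using integrable_of_scale_measure_le[OF minor(1) _ _ _ \<epsilon>, of V] admissible_P[OF x(1)] \<nu> V_nonneg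
    by (simp add: admissible_def)
  then have "admissible \<nu>"
    using \<nu> by (simp add: admissible_def)
  then show ?thesis
    using \<epsilon> by (intro integral_P_diff_le[OF f c \<theta> x _ _ minor]) auto
qed

lemma integral_P_diff_le_trivial:
  assumes f: "osc_le \<theta> c f" and c: "0 \<le> c" and \<theta>: "0 \<le> \<theta>" and x: "x \<in> space M" "y \<in> space M"
  shows "(\<integral>u. f u \<partial>P x) - (\<integral>u. f u \<partial>P y) \<le> c * (2 + 2 * \<theta> * b + \<theta> * \<alpha> * (V x + V y))"
proof -
  have "sets (P x) = sets (P y)"
    using admissible_P x by (simp add: admissible_def)
  then have "scale_measure (ennreal 0) (P x) \<le> P z" if "z \<in> {x, y}" for z
    using that by (auto simp: le_measure)
  then show ?thesis
    using integral_P_diff_le[OF f c \<theta> x admissible_P[OF x(1)], of 0] by simp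
qed

lemma contraction_rate:
  assumes S: "2 * b < (1 - \<alpha>) * S" and \<epsilon>: "0 < \<epsilon>"
  obtains \<theta> \<rho> where "0 < \<theta>" "0 \<le> \<rho>" "\<rho> < 1"
    "\<And>s. 0 \<le> s \<Longrightarrow> 2 * (1 - \<epsilon>) + 2 * \<theta> * b + \<theta> * \<alpha> * s \<le> \<rho> * (2 + \<theta> * s)"
    "\<And>s. S \<le> s \<Longrightarrow> 2 + 2 * \<theta> * b + \<theta> * \<alpha> * s \<le> \<rho> * (2 + \<theta> * s)"
proof -
  define \<theta> where "\<theta> = \<epsilon> / (2 * (b + 1))"
  have \<theta>: "0 < \<theta>" "2 * \<theta> * b \<le> \<epsilon>"
    using \<epsilon> b_nonneg by (simp_all add: \<theta>_def field_simps)
  have "0 < (1 - \<alpha>) * S"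
    using S b_nonneg by linarith
  then have "0 < S"
    using rate by (simp add: zero_less_mult_iff)
  then have pos: "0 < 2 + \<theta> * S"
    using \<theta> by (simp add: add_pos_pos)
  define \<delta> where "\<delta> = \<theta> * ((1 - \<alpha>) * S - 2 * b) / (2 + \<theta> * S)"
  have \<delta>: "0 < \<delta>" "\<delta> * (2 + \<theta> * S) = \<theta> * ((1 - \<alpha>) * S - 2 * b)"
    using S \<theta> pos by (simp_all add: \<delta>_def)
  define \<rho> where "\<rho> = Max {\<alpha>, 1 - \<epsilon> / 2, 1 - \<delta>}"
  have \<rho>: "\<alpha> \<le> \<rho>" "1 - \<epsilon> / 2 \<le> \<rho>" "1 - \<delta> \<le> \<rho>" "\<rho> < 1" "0 \<le> \<rho>"
    using rate \<epsilon> \<delta> by (auto simp: \<rho>_def)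
  show thesis
  proof (rule that[OF \<theta>(1) \<rho>(5,4)])
    fix s :: real assume "0 \<le> s"
    then have "\<theta> * \<alpha> * s \<le> \<theta> * \<rho> * s"
      using \<rho> \<theta> by (intro mult_right_mono mult_left_mono) auto
    then show "2 * (1 - \<epsilon>) + 2 * \<theta> * b + \<theta> * \<alpha> * s \<le> \<rho> * (2 + \<theta> * s)"
      using \<rho>(2) \<theta>(2) by (simp add: algebra_simps)
  next
    fix s assume "S \<le> s"
    have "(1 - \<rho>) * (2 + \<theta> * S) \<le> \<delta> * (2 + \<theta> * S)"
      using \<rho>(3) pos by (intro mult_right_mono) auto
    then have "2 * (1 - \<rho>) \<le> \<theta> * ((\<rho> - \<alpha>) * S - 2 * b)"
      unfolding \<delta>(2) by (simp add: algebra_simps)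
    moreover have "\<theta> * ((\<rho> - \<alpha>) * S) \<le> \<theta> * ((\<rho> - \<alpha>) * s)"
      using \<rho> \<theta> \<open>S \<le> s\<close> by (intro mult_left_mono) auto
    ultimately show "2 + 2 * \<theta> * b + \<theta> * \<alpha> * s \<le> \<rho> * (2 + \<theta> * s)"
      by (simp add: algebra_simps)
  qed
qed

lemma osc_le_contraction:
  assumes S: "2 * b < (1 - \<alpha>) * S" and \<epsilon>: "0 < \<epsilon>"
    and \<nu>: "prob_space \<nu>" "sets \<nu> = sets M"
    and minor: "\<And>x. x \<in> space M \<Longrightarrow> V x \<le> S \<Longrightarrow> scale_measure (ennreal \<epsilon>) \<nu> \<le> P x"
  obtains \<theta> \<rho> where "0 < \<theta>" "0 \<le> \<rho>" "\<rho> < 1"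
    "\<And>c f. 0 \<le> c \<Longrightarrow> osc_le \<theta> c f \<Longrightarrow> osc_le \<theta> (\<rho> * c) (\<lambda>x. \<integral>y. f y \<partial>P x)"
proof -
  obtain \<theta> \<rho> where \<theta>: "0 < \<theta>" and \<rho>: "0 \<le> \<rho>" "\<rho> < 1"
    and near: "\<And>s. 0 \<le> s \<Longrightarrow> 2 * (1 - \<epsilon>) + 2 * \<theta> * b + \<theta> * \<alpha> * s \<le> \<rho> * (2 + \<theta> * s)"
    and far: "\<And>s. S \<le> s \<Longrightarrow> 2 + 2 * \<theta> * b + \<theta> * \<alpha> * s \<le> \<rho> * (2 + \<theta> * s)"
    using contraction_rate[OF S \<epsilon>] by blast
  have "(\<integral>u. f u \<partial>P x) - (\<integral>u. f u \<partial>P y) \<le> \<rho> * c * (2 + \<theta> * V x + \<theta> * V y)"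
    if c: "0 \<le> c" and f: "osc_le \<theta> c f" and x: "x \<in> space M" "y \<in> space M" for c f x y
  proof -
    have "(\<integral>u. f u \<partial>P x) - (\<integral>u. f u \<partial>P y) \<le> c * (\<rho> * (2 + \<theta> * (V x + V y)))"
    proof (cases "V x + V y \<le> S")
      case True
      then have "V x \<le> S" "V y \<le> S"
        using V_nonneg[of x] V_nonneg[of y] by auto
      then have "(\<integral>u. f u \<partial>P x) - (\<integral>u. f u \<partial>P y)
          \<le> c * (2 * (1 - \<epsilon>) + 2 * \<theta> * b + \<theta> * \<alpha> * (V x + V y))"
        using \<theta> by (intro integral_P_diff_le_small_set[OF f c _ x \<nu> \<epsilon>] minor x) auto
      also have "\<dots> \<le> c * (\<rho> * (2 + \<theta> * (V x + V y)))"
        using V_nonneg by (intro mult_left_mono near c add_nonneg_nonneg)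
      finally show ?thesis .
    next
      case False
      have "(\<integral>u. f u \<partial>P x) - (\<integral>u. f u \<partial>P y) \<le> c * (2 + 2 * \<theta> * b + \<theta> * \<alpha> * (V x + V y))"
        using \<theta> by (intro integral_P_diff_le_trivial[OF f c _ x]) auto
      also have "\<dots> \<le> c * (\<rho> * (2 + \<theta> * (V x + V y)))"
        using False by (intro mult_left_mono far c) auto
      finally show ?thesis .
    qed
    then show ?thesis
      by (simp add: algebra_simps)
  qed
  then show thesis
    using that[OF \<theta> \<rho>] V_bounded_P by (simp add: osc_le_def)
qed

lemma osc_le_iter:
  assumes contr: "\<And>c f. 0 \<le> c \<Longrightarrow> osc_le \<theta> c f \<Longrightarrow> osc_le \<theta> (\<rho> * c) (\<lambda>x. \<integral>y. f y \<partial>P x)"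
    and rho: "0 \<le> \<rho>"
  shows "0 \<le> c \<Longrightarrow> osc_le \<theta> c f \<Longrightarrow> osc_le \<theta> (\<rho> ^ k * c) (\<lambda>x. \<integral>y. f y \<partial>kernel_iter M P k x)"
proof (induction k arbitrary: c f)
  case 0
  then have "f \<in> borel_measurable M"
    by (simp add: osc_le_def V_bounded_def)
  then show ?case
    using 0 by (simp add: integral_return osc_le_def V_bounded_def cong: measurable_cong)
next
  case (Suc k)
  have "osc_le \<theta> (\<rho> ^ k * (\<rho> * c)) (\<lambda>x. \<integral>y. (\<integral>z. f z \<partial>P y) \<partial>kernel_iter M P k x)"
    by (intro Suc.IH contr Suc.prems mult_nonneg_nonneg rho)
  moreover have "(\<integral>z. f z \<partial>kernel_iter M P (Suc k) x) = (\<integral>y. (\<integral>z. f z \<partial>P y) \<partial>kernel_iter M P k x)"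
    if "x \<in> space M" for x
    using Suc.prems that by (simp add: osc_le_def integral_bind_V_bounded admissible_iter)
  ultimately show ?case
    by (simp add: osc_le_def V_bounded_def mult_ac cong: measurable_cong)
qed

lemma integral_diff_le_of_osc_le:
  assumes N: "admissible N" and F: "osc_le \<theta> c F" and x: "x \<in> space M"
  shows "F x - (\<integral>y. F y \<partial>N) \<le> c * (2 + \<theta> * V x + \<theta> * (\<integral>y. V y \<partial>N))"
proof -
  interpret N: prob_space N
    using N by (simp add: admissible_def)
  have int: "integrable N F" "integrable N V"
    using N F integrable_V_bounded V_bounded_V by (auto simp: osc_le_def)
  have "F x - (\<integral>y. F y \<partial>N) = (\<integral>y. F x - F y \<partial>N)"
    using int by (simp add: N.prob_space)
  also have "\<dots> \<le> (\<integral>y. c * (2 + \<theta> * V x + \<theta> * V y) \<partial>N)"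
    using int F x admissible_space[OF N] by (intro integral_mono) (auto simp: osc_le_def)
  also have "\<dots> = c * (2 + \<theta> * V x + \<theta> * (\<integral>y. V y \<partial>N))"
    using int by (simp add: N.prob_space)
  finally show ?thesis .
qed

lemma kernel_iter_convergence:
  assumes \<theta>: "0 < \<theta>" and \<rho>: "0 \<le> \<rho>"
    and contr: "\<And>c f. 0 \<le> c \<Longrightarrow> osc_le \<theta> c f \<Longrightarrow> osc_le \<theta> (\<rho> * c) (\<lambda>x. \<integral>y. f y \<partial>P x)"
    and N: "admissible N" "N \<bind> P = N"
    and f: "f \<in> borel_measurable M" "\<And>x. x \<in> space M \<Longrightarrow> \<bar>f x\<bar> \<le> V x" and x: "x \<in> space M"
  shows "(\<integral>y. f y \<partial>kernel_iter M P k x) - (\<integral>y. f y \<partial>N) \<le> (2 / \<theta> + (\<integral>y. V y \<partial>N) + 1) * \<rho> ^ k * V x"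
proof -
  define v where "v = (\<integral>y. V y \<partial>N)"
  have v: "0 \<le> v"
    using V_nonneg by (simp add: v_def integral_nonneg_AE)
  have vf: "V_bounded f"
    using f by (auto simp: V_bounded_def intro!: exI[of _ 1])
  have "f x - f y \<le> 1 / \<theta> * (2 + \<theta> * V x + \<theta> * V y)" if "x \<in> space M" "y \<in> space M" for x y
  proof -
    have "f x - f y \<le> V x + V y"
      using f(2)[OF that(1)] f(2)[OF that(2)] by linarith
    also have "\<dots> \<le> 1 / \<theta> * (2 + \<theta> * V x + \<theta> * V y)"
      using \<theta> by (simp add: field_simps)
    finally show ?thesis .
  qed
  then have "osc_le \<theta> (1 / \<theta>) f"
    using vf by (simp add: osc_le_def)
  then have "osc_le \<theta> (\<rho> ^ k * (1 / \<theta>)) (\<lambda>x. \<integral>y. f y \<partial>kernel_iter M P k x)"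
    using \<theta> \<rho> contr by (intro osc_le_iter) auto
  from integral_diff_le_of_osc_le[OF N(1) this x]
  have "(\<integral>y. f y \<partial>kernel_iter M P k x) - (\<integral>y. f y \<partial>N) \<le> \<rho> ^ k * (1 / \<theta>) * (2 + \<theta> * V x + \<theta> * v)"
    by (simp only: integral_iter_invariant[OF N vf] v_def)
  also have "\<dots> = \<rho> ^ k * ((2 / \<theta> + v) * 1 + V x)"
    using \<theta> by (simp add: field_simps)
  also have "\<dots> \<le> \<rho> ^ k * ((2 / \<theta> + v) * V x + V x)"
    using \<rho> \<theta> v V_ge_1[of x] by (intro mult_left_mono add_right_mono) auto
  also have "\<dots> = (2 / \<theta> + v + 1) * \<rho> ^ k * V x"
    by (simp add: algebra_simps)
  finally show ?thesis
    by (simp add: v_def)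
qed

theorem harris:
  assumes S: "2 * b < (1 - \<alpha>) * S" and \<epsilon>: "0 < \<epsilon>"
    and \<nu>: "prob_space \<nu>" "sets \<nu> = sets M"
    and minor: "\<And>x. x \<in> space M \<Longrightarrow> V x \<le> S \<Longrightarrow> scale_measure (ennreal \<epsilon>) \<nu> \<le> P x"
    and N: "admissible N" "N \<bind> P = N"
  obtains C \<rho> where "0 \<le> C" "0 \<le> \<rho>" "\<rho> < 1"
    "\<And>f x k. f \<in> borel_measurable M \<Longrightarrow> (\<And>x. x \<in> space M \<Longrightarrow> \<bar>f x\<bar> \<le> V x) \<Longrightarrow> x \<in> space M \<Longrightarrow>
       \<bar>(\<integral>y. f y \<partial>kernel_iter M P k x) - (\<integral>y. f y \<partial>N)\<bar> \<le> C * \<rho> ^ k * V x"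
proof -
  obtain \<theta> \<rho> where \<theta>: "0 < \<theta>" and \<rho>: "0 \<le> \<rho>" "\<rho> < 1"
    and contr: "\<And>c f. 0 \<le> c \<Longrightarrow> osc_le \<theta> c f \<Longrightarrow> osc_le \<theta> (\<rho> * c) (\<lambda>x. \<integral>y. f y \<partial>P x)"
    using osc_le_contraction[OF S \<epsilon> \<nu> minor] by blast
  define C where "C = 2 / \<theta> + (\<integral>y. V y \<partial>N) + 1"
  show thesis
  proof (rule that[OF _ \<rho>])
    show "0 \<le> C"
      using \<theta> V_nonneg by (simp add: C_def integral_nonneg_AE)
    show "\<bar>(\<integral>y. f y \<partial>kernel_iter M P k x) - (\<integral>y. f y \<partial>N)\<bar> \<le> C * \<rho> ^ k * V x"
      if "f \<in> borel_measurable M" "\<And>x. x \<in> space M \<Longrightarrow> \<bar>f x\<bar> \<le> V x" "x \<in> space M" for f x k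
      using kernel_iter_convergence[OF \<theta> \<rho>(1) contr N, of f x k]
        kernel_iter_convergence[OF \<theta> \<rho>(1) contr N, of "\<lambda>x. - f x" x k] that
      by (simp add: abs_le_iff C_def)
  qed
qed

end

section \<open>Metropolis--Hastings kernels\<close>

lemma emeasure_measure_of_add:
  assumes sets: "sets N = sets M" "sets N' = sets M"
    and \<mu>: "\<And>A. A \<in> sets M \<Longrightarrow> \<mu> A = emeasure N A + emeasure N' A" and A: "A \<in> sets M"
  shows "emeasure (measure_of (space M) (sets M) \<mu>) A = emeasure N A + emeasure N' A"
proof -
  have "countably_additive (sets M) \<mu>"
    unfolding countably_additive_def
  proof (intro allI impI)
    fix B :: "nat \<Rightarrow> 'a set" assume B: "range B \<subseteq> sets M" "disjoint_family B" "(\<Union>i. B i) \<in> sets M"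
    have "(\<Sum>i. \<mu> (B i)) = (\<Sum>i. emeasure N (B i)) + (\<Sum>i. emeasure N' (B i))"
      using B(1) by (subst suminf_add) (auto simp: \<mu> subset_eq)
    also have "\<dots> = \<mu> (\<Union>i. B i)"
      using B by (simp add: \<mu> suminf_emeasure sets)
    finally show "(\<Sum>i. \<mu> (B i)) = \<mu> (\<Union>i. B i)" .
  qed
  moreover have "positive (sets M) \<mu>"
    by (simp add: positive_def \<mu>)
  ultimately show ?thesis
    using A \<mu> by (simp add: emeasure_measure_of_sigma sets.sigma_algebra_axioms)
qed

lemma nn_integral_add_measure:
  assumes sets: "sets K = sets M" "sets N = sets M" "sets N' = sets M"
    and K: "\<And>A. A \<in> sets M \<Longrightarrow> emeasure K A = emeasure N A + emeasure N' A"
    and "f \<in> borel_measurable M"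
  shows "(\<integral>\<^sup>+y. f y \<partial>K) = (\<integral>\<^sup>+y. f y \<partial>N) + (\<integral>\<^sup>+y. f y \<partial>N')"
  using assms(5)
proof (induction rule: borel_measurable_induct)
  case (cong f g)
  then show ?case
    using sets[THEN sets_eq_imp_space_eq] by (metis nn_integral_cong)
next
  case (set A)
  then show ?case
    by (simp add: K sets)
next
  case (mult u c)
  note [measurable_cong] = sets and [measurable] = mult.hyps(2)
  show ?case
    by (simp add: nn_integral_cmult mult.IH distrib_left)
next
  case (add u v)
  note [measurable_cong] = sets and [measurable] = add.hyps(1,3)
  have "(\<integral>\<^sup>+y. v y + u y \<partial>Q) = (\<integral>\<^sup>+y. v y \<partial>Q) + (\<integral>\<^sup>+y. u y \<partial>Q)"
    if [measurable_cong]: "sets Q = sets M" for Q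
    by (intro nn_integral_add) measurable
  then show ?case
    by (simp add: sets add.IH ac_simps)
next
  case (seq F)
  note [measurable_cong] = sets and [measurable] = seq(1)
  have "(\<integral>\<^sup>+y. (SUP i. F i) y \<partial>Q) = (SUP i. \<integral>\<^sup>+y. F i y \<partial>Q)"
    if [measurable_cong]: "sets Q = sets M" for Q
    unfolding SUP_apply by (intro nn_integral_monotone_convergence_SUP seq) measurable
  moreover have "(SUP i. (\<integral>\<^sup>+y. F i y \<partial>N) + (\<integral>\<^sup>+y. F i y \<partial>N'))
      = (SUP i. \<integral>\<^sup>+y. F i y \<partial>N) + (SUP i. \<integral>\<^sup>+y. F i y \<partial>N')"
    using seq(3)
    by (intro ennreal_SUP_add) (auto simp: incseq_def le_fun_def intro!: nn_integral_mono)
  ultimately show ?case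
    by (simp add: sets seq.IH)
qed

definition mh_kernel :: "'a measure \<Rightarrow> ('a \<Rightarrow> 'a \<Rightarrow> real) \<Rightarrow> ('a \<Rightarrow> 'a \<Rightarrow> real) \<Rightarrow> 'a \<Rightarrow> 'a measure" where
  "mh_kernel M a q x = measure_of (space M) (sets M)
     (\<lambda>A. (\<integral>\<^sup>+y. indicator A y * ennreal (a x y * q x y) \<partial>M)
        + indicator A x * (\<integral>\<^sup>+y. ennreal ((1 - a x y) * q x y) \<partial>M))"

locale metropolis_hastings = sigma_finite_measure M
  for M :: "'a measure" +
  fixes a q :: "'a \<Rightarrow> 'a \<Rightarrow> real"
  assumes measurable_acceptance: "case_prod a \<in> borel_measurable (M \<Otimes>\<^sub>M M)"
    and measurable_proposal: "case_prod q \<in> borel_measurable (M \<Otimes>\<^sub>M M)"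
    and acceptance_nonneg: "0 \<le> a x y" and acceptance_le_1: "a x y \<le> 1"
    and proposal_nonneg: "0 \<le> q x y"
    and proposal_mass: "x \<in> space M \<Longrightarrow> (\<integral>\<^sup>+y. ennreal (q x y) \<partial>M) = 1"
begin

abbreviation P :: "'a \<Rightarrow> 'a measure" where
  "P \<equiv> mh_kernel M a q"

definition acc_prob :: "'a \<Rightarrow> ennreal" where
  "acc_prob x = (\<integral>\<^sup>+y. ennreal (a x y * q x y) \<partial>M)"

definition rej_prob :: "'a \<Rightarrow> ennreal" where
  "rej_prob x = (\<integral>\<^sup>+y. ennreal ((1 - a x y) * q x y) \<partial>M)"

lemma measurable_acceptance_proposal [measurable (raw)]:
  assumes "f \<in> N \<rightarrow>\<^sub>M M" "g \<in> N \<rightarrow>\<^sub>M M"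
  shows "(\<lambda>z. a (f z) (g z)) \<in> borel_measurable N" "(\<lambda>z. q (f z) (g z)) \<in> borel_measurable N"
  using measurable_compose[OF measurable_Pair[OF assms] measurable_acceptance]
    measurable_compose[OF measurable_Pair[OF assms] measurable_proposal]
  by simp_all

lemma rej_prob_measurable [measurable]: "rej_prob \<in> borel_measurable M"
  unfolding rej_prob_def by measurable

lemma sets_mh_kernel [simp, measurable_cong]: "sets (P x) = sets M"
  by (simp add: mh_kernel_def)

lemma nn_integral_mh_kernel:
  assumes x[measurable]: "x \<in> space M" and f[measurable]: "f \<in> borel_measurable M"
  shows "(\<integral>\<^sup>+y. f y \<partial>P x) = (\<integral>\<^sup>+y. ennreal (a x y * q x y) * f y \<partial>M) + rej_prob x * f x"
proof -
  define N where "N = density M (\<lambda>y. ennreal (a x y * q x y))"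
  define N' where "N' = scale_measure (rej_prob x) (return M x)"
  have "emeasure (P x) A = emeasure N A + emeasure N' A" if A: "A \<in> sets M" for A
    unfolding mh_kernel_def using A
    by (intro emeasure_measure_of_add)
      (auto simp: N_def N'_def emeasure_density rej_prob_def mult.commute)
  then have "(\<integral>\<^sup>+y. f y \<partial>P x) = (\<integral>\<^sup>+y. f y \<partial>N) + (\<integral>\<^sup>+y. f y \<partial>N')"
    by (intro nn_integral_add_measure[where M = M]) (simp_all add: N_def N'_def)
  then show ?thesis
    by (simp add: N_def N'_def nn_integral_density nn_integral_scale_measure nn_integral_return x f)
qed

lemma emeasure_mh_kernel:
  assumes "x \<in> space M" "A \<in> sets M"
  shows "emeasure (P x) A
    = (\<integral>\<^sup>+y. ennreal (a x y * q x y) * indicator A y \<partial>M) + rej_prob x * indicator A x"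
  using nn_integral_mh_kernel[OF assms(1), of "indicator A"] assms(2) by simp

lemma acc_prob_plus_rej_prob:
  assumes x[measurable]: "x \<in> space M"
  shows "acc_prob x + rej_prob x = 1"
proof -
  have "acc_prob x + rej_prob x = (\<integral>\<^sup>+y. ennreal (a x y * q x y) + ennreal ((1 - a x y) * q x y) \<partial>M)"
    unfolding acc_prob_def rej_prob_def by (intro nn_integral_add[symmetric]) measurable
  also have "\<dots> = (\<integral>\<^sup>+y. ennreal (q x y) \<partial>M)"
    using acceptance_nonneg acceptance_le_1 proposal_nonneg
    by (intro nn_integral_cong, subst ennreal_plus[symmetric])
      (auto simp: left_diff_distrib mult_left_le_one_le)
  also have "\<dots> = 1"
    by (rule proposal_mass[OF x])
  finally show ?thesis .
qed

lemma mh_kernel_measurable: "P \<in> M \<rightarrow>\<^sub>M prob_algebra M"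
proof (rule measurable_prob_algebraI)
  show prob: "prob_space (P x)" if "x \<in> space M" for x
  proof (rule prob_spaceI)
    have "emeasure (P x) (space (P x)) = acc_prob x + rej_prob x"
      using that sets_eq_imp_space_eq[OF sets_mh_kernel]
      by (auto simp: emeasure_mh_kernel acc_prob_def intro!: nn_integral_cong)
    then show "emeasure (P x) (space (P x)) = 1"
      using that by (simp add: acc_prob_plus_rej_prob)
  qed
  show "P \<in> M \<rightarrow>\<^sub>M subprob_algebra M"
  proof (rule measurable_subprob_algebra)
    fix A assume [measurable]: "A \<in> sets M"
    have "(\<lambda>x. (\<integral>\<^sup>+y. ennreal (a x y * q x y) * indicator A y \<partial>M) + rej_prob x * indicator A x)
        \<in> borel_measurable M"
      by measurable
    then show "(\<lambda>x. emeasure (P x) A) \<in> borel_measurable M"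
      by (simp add: emeasure_mh_kernel cong: measurable_cong)
  qed (auto intro: prob prob_space_imp_subprob_space)
qed

lemma nn_integral_mh_kernel_le:
  assumes "x \<in> space M" and f: "f \<in> borel_measurable M"
  shows "(\<integral>\<^sup>+y. f y \<partial>P x) \<le> (\<integral>\<^sup>+y. ennreal (q x y) * f y \<partial>M) + rej_prob x * f x"
  unfolding nn_integral_mh_kernel[OF assms]
  using acceptance_nonneg acceptance_le_1 proposal_nonneg
  by (intro add_right_mono nn_integral_mono mult_right_mono ennreal_leI mult_left_le_one_le) auto

lemma rej_prob_le:
  assumes "x \<in> space M" and p: "ennreal p \<le> acc_prob x" "0 \<le> p"
  shows "rej_prob x \<le> ennreal (1 - p)"
proof -
  have "rej_prob x + ennreal p \<le> 1"
    using acc_prob_plus_rej_prob[OF assms(1)] p(1) by (metis add.commute add_left_mono)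
  then show ?thesis
    using p(2) by (simp add: ennreal_le_minus_iff ennreal_minus[symmetric])
qed

lemma accepted_mass_ge:
  assumes [measurable]: "B \<in> sets M" "A \<in> sets M" "x \<in> space M"
    and \<delta>: "\<And>y. y \<in> B \<Longrightarrow> \<delta> \<le> a x y * q x y"
  shows "ennreal \<delta> * emeasure M (B \<inter> A) \<le> (\<integral>\<^sup>+y. ennreal (a x y * q x y) * indicator A y \<partial>M)"
proof -
  have "ennreal \<delta> * emeasure M (B \<inter> A) = (\<integral>\<^sup>+y. ennreal \<delta> * indicator (B \<inter> A) y \<partial>M)"
    by (subst nn_integral_cmult_indicator) auto
  also have "\<dots> \<le> (\<integral>\<^sup>+y. ennreal (a x y * q x y) * indicator A y \<partial>M)"
    using \<delta> by (intro nn_integral_mono) (auto simp: indicator_def intro: ennreal_leI)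
  finally show ?thesis .
qed

lemma acc_prob_ge:
  assumes "B \<in> sets M" "x \<in> space M" "\<And>y. y \<in> B \<Longrightarrow> \<delta> \<le> a x y * q x y"
  shows "ennreal \<delta> * emeasure M B \<le> acc_prob x"
  using accepted_mass_ge[OF assms(1) sets.top assms(2,3)] sets.sets_into_space[OF assms(1)]
  by (simp add: acc_prob_def Int_absorb2 cong: nn_integral_cong)

lemma minorization:
  assumes B: "B \<in> sets M" "0 < emeasure M B" "emeasure M B \<noteq> \<infinity>" and x: "x \<in> space M"
    and \<delta>: "\<And>y. y \<in> B \<Longrightarrow> \<delta> \<le> a x y * q x y"
  shows "scale_measure (ennreal \<delta> * emeasure M B) (uniform_measure M B) \<le> P x"
proof (subst le_measure, simp, intro ballI)
  fix A assume "A \<in> sets (scale_measure (ennreal \<delta> * emeasure M B) (uniform_measure M B))"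
  then have A: "A \<in> sets M"
    by simp
  have "ennreal \<delta> * emeasure M B * (emeasure M (B \<inter> A) / emeasure M B)
      = ennreal \<delta> * (emeasure M (B \<inter> A) * emeasure M B / emeasure M B)"
    by (simp add: divide_ennreal_def ac_simps)
  also have "\<dots> = ennreal \<delta> * emeasure M (B \<inter> A)"
    using B by (simp add: ennreal_mult_divide_eq)
  also have "\<dots> \<le> emeasure (P x) A"
    using accepted_mass_ge[OF B(1) A x \<delta>] by (simp add: emeasure_mh_kernel[OF x A] add_increasing2)
  finally show "emeasure (scale_measure (ennreal \<delta> * emeasure M B) (uniform_measure M B)) A
      \<le> emeasure (P x) A"
    using A B by simp
qed

lemma density_invariant:
  fixes p :: "'a \<Rightarrow> ennreal"
  assumes p[measurable]: "p \<in> borel_measurable M" and nonempty: "space M \<noteq> {}"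
    and balance: "\<And>x y. x \<in> space M \<Longrightarrow> y \<in> space M \<Longrightarrow>
      p x * ennreal (a x y * q x y) = p y * ennreal (a y x * q y x)"
  shows "density M p \<bind> P = density M p"
proof (rule measure_eqI)
  interpret pair_sigma_finite M M ..
  have P: "P \<in> density M p \<rightarrow>\<^sub>M subprob_algebra M"
    using measurable_prob_algebraD[OF mh_kernel_measurable] by (simp cong: measurable_cong_sets)
  show sets: "sets (density M p \<bind> P) = sets (density M p)"
    using nonempty by (subst sets_bind[where N = M]) auto
  fix A assume "A \<in> sets (density M p \<bind> P)"
  then have A[measurable]: "A \<in> sets M"
    using sets by simp
  define k where "k x y = p x * ennreal (a x y * q x y)" for x y
  have [measurable]: "(\<lambda>z. k (f z) (g z)) \<in> borel_measurable N"
    if [measurable]: "f \<in> N \<rightarrow>\<^sub>M M" "g \<in> N \<rightarrow>\<^sub>M M" for f g and N :: "'b measure"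
    unfolding k_def by measurable
  have "(\<integral>\<^sup>+x. \<integral>\<^sup>+y. k x y * indicator A y \<partial>M \<partial>M) = (\<integral>\<^sup>+y. \<integral>\<^sup>+x. k x y * indicator A y \<partial>M \<partial>M)"
    by (rule Fubini') measurable
  also have "\<dots> = (\<integral>\<^sup>+x. (\<integral>\<^sup>+y. k x y \<partial>M) * indicator A x \<partial>M)"
    using balance by (simp add: nn_integral_multc k_def cong: nn_integral_cong)
  finally have accepted: "(\<integral>\<^sup>+x. \<integral>\<^sup>+y. k x y * indicator A y \<partial>M \<partial>M)
      = (\<integral>\<^sup>+x. p x * acc_prob x * indicator A x \<partial>M)"
    by (simp add: k_def acc_prob_def nn_integral_cmult cong: nn_integral_cong)
  have "emeasure (density M p \<bind> P) A = (\<integral>\<^sup>+x. emeasure (P x) A \<partial>density M p)"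
    using nonempty P A by (intro emeasure_bind) auto
  also have "\<dots> = (\<integral>\<^sup>+x. p x * emeasure (P x) A \<partial>M)"
    using measurable_emeasure_kernel[OF measurable_prob_algebraD[OF mh_kernel_measurable] A]
    by (intro nn_integral_density) auto
  also have "\<dots> = (\<integral>\<^sup>+x. (\<integral>\<^sup>+y. k x y * indicator A y \<partial>M) + p x * rej_prob x * indicator A x \<partial>M)"
    by (simp add: emeasure_mh_kernel[OF _ A] distrib_left k_def mult.assoc nn_integral_cmult
        cong: nn_integral_cong)
  also have "\<dots> = (\<integral>\<^sup>+x. p x * acc_prob x * indicator A x \<partial>M)
      + (\<integral>\<^sup>+x. p x * rej_prob x * indicator A x \<partial>M)"
    unfolding accepted[symmetric] by (intro nn_integral_add) measurable
  also have "\<dots> = (\<integral>\<^sup>+x. p x * acc_prob x * indicator A x + p x * rej_prob x * indicator A x \<partial>M)"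
    unfolding acc_prob_def by (intro nn_integral_add[symmetric]) measurable
  also have "\<dots> = (\<integral>\<^sup>+x. p x * indicator A x \<partial>M)"
    by (simp add: acc_prob_plus_rej_prob flip: distrib_left distrib_right cong: nn_integral_cong)
  also have "\<dots> = emeasure (density M p) A"
    by (simp add: emeasure_density)
  finally show "emeasure (density M p \<bind> P) A = emeasure (density M p) A" .
qed

end

section \<open>Gaussian densities\<close>

definition gaussian_density :: "'a::euclidean_space \<Rightarrow> real \<Rightarrow> 'a \<Rightarrow> real" where
  "gaussian_density \<mu> \<sigma> y =
     (2 * pi * \<sigma>\<^sup>2) powr (- real DIM('a) / 2) * exp (- (norm (y - \<mu>))\<^sup>2 / (2 * \<sigma>\<^sup>2))"

lemma gaussian_density_eq_prod_normal_density:
  fixes \<mu> y :: "'a::euclidean_space"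
  assumes "0 < \<sigma>"
  shows "gaussian_density \<mu> \<sigma> y = (\<Prod>b\<in>Basis. normal_density (\<mu> \<bullet> b) \<sigma> (y \<bullet> b))"
proof -
  have "(\<Prod>b\<in>Basis. normal_density (\<mu> \<bullet> b) \<sigma> (y \<bullet> b))
    = (\<Prod>b\<in>(Basis::'a set). 1 / sqrt (2 * pi * \<sigma>\<^sup>2)) * exp (\<Sum>b\<in>Basis. - ((y - \<mu>) \<bullet> b)\<^sup>2 / (2 * \<sigma>\<^sup>2))"
    by (simp add: normal_density_def exp_sum prod_dividef power_one_over inner_diff_left)
  also have "(\<Sum>b\<in>Basis. - ((y - \<mu>) \<bullet> b)\<^sup>2 / (2 * \<sigma>\<^sup>2)) = - (norm (y - \<mu>))\<^sup>2 / (2 * \<sigma>\<^sup>2)"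
    unfolding power2_norm_eq_inner euclidean_inner[of "y - \<mu>" "y - \<mu>"]
    by (simp only: sum_divide_distrib sum_negf[symmetric] power2_eq_square)
  also have "(\<Prod>b\<in>(Basis::'a set). 1 / sqrt (2 * pi * \<sigma>\<^sup>2)) = (2 * pi * \<sigma>\<^sup>2) powr (- real DIM('a) / 2)"
    using assms by (simp add: powr_half_sqrt[symmetric] power_divide powr_minus_divide powr_power)
  finally show ?thesis
    by (simp add: gaussian_density_def)
qed

lemma gaussian_density_pos: "\<sigma> \<noteq> 0 \<Longrightarrow> 0 < gaussian_density \<mu> \<sigma> y"
  by (simp add: gaussian_density_def)

lemma nn_integral_gaussian_density:
  fixes \<mu> :: "'a::euclidean_space"
  assumes "0 < \<sigma>"
  shows "(\<integral>\<^sup>+y. ennreal (gaussian_density \<mu> \<sigma> y) \<partial>lborel) = 1"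
proof -
  have "(\<integral>\<^sup>+y. ennreal (gaussian_density \<mu> \<sigma> y) \<partial>lborel)
    = (\<integral>\<^sup>+y. (\<Prod>b\<in>Basis. ennreal (normal_density (\<mu> \<bullet> b) \<sigma> (y \<bullet> b))) \<partial>lborel)"
    by (simp add: gaussian_density_eq_prod_normal_density[OF assms] prod_ennreal)
  also have "\<dots> = (\<Prod>b\<in>(Basis::'a set). \<integral>\<^sup>+t. ennreal (normal_density (\<mu> \<bullet> b) \<sigma> t) \<partial>lborel)"
    by (rule nn_integral_lborel_prod) auto
  also have "\<dots> = 1"
    using assms by (simp add: nn_integral_eq_integral)
  finally show ?thesis .
qed

text \<open>Doubling the variance absorbs an exponential weight, so no moment has to be computed.\<close>

lemma exp_norm_gaussian_density_le:
  fixes \<mu> y :: "'a::euclidean_space"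
  assumes "0 < \<sigma>" "0 \<le> \<eta>"
  shows "exp (\<eta> * norm y) * gaussian_density \<mu> \<sigma> y
    \<le> 2 powr (real DIM('a) / 2) * exp (\<eta>\<^sup>2 * \<sigma>\<^sup>2 + \<eta> * norm \<mu>) * gaussian_density \<mu> (sqrt 2 * \<sigma>) y"
proof -
  define s where "s = norm (y - \<mu>)"
  define Z where "Z = (2 * pi * \<sigma>\<^sup>2) powr (- real DIM('a) / 2)"
  have "2 * pi * (sqrt 2 * \<sigma>)\<^sup>2 = 2 * (2 * pi * \<sigma>\<^sup>2)"
    by (simp add: power_mult_distrib)
  then have "gaussian_density \<mu> (sqrt 2 * \<sigma>) y
      = 2 powr (- real DIM('a) / 2) * Z * exp (- s\<^sup>2 / (2 * (sqrt 2 * \<sigma>)\<^sup>2))"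
    by (simp only: gaussian_density_def Z_def s_def powr_mult)
  moreover have "2 powr (real DIM('a) / 2) * 2 powr (- real DIM('a) / 2) = (1 :: real)"
    by (simp flip: powr_add)
  ultimately have density: "gaussian_density \<mu> \<sigma> y = Z * exp (- s\<^sup>2 / (2 * \<sigma>\<^sup>2))"
    "2 powr (real DIM('a) / 2) * gaussian_density \<mu> (sqrt 2 * \<sigma>) y = Z * exp (- s\<^sup>2 / (4 * \<sigma>\<^sup>2))"
    by (simp_all add: gaussian_density_def Z_def s_def power_mult_distrib flip: mult.assoc)
  have "0 \<le> (s / (2 * \<sigma>) - \<eta> * \<sigma>)\<^sup>2"
    by simp
  also have "\<dots> = \<eta>\<^sup>2 * \<sigma>\<^sup>2 - s\<^sup>2 / (4 * \<sigma>\<^sup>2) - (\<eta> * s - s\<^sup>2 / (2 * \<sigma>\<^sup>2))"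
    using assms by (simp add: power2_eq_square field_simps)
  finally have "\<eta> * s - s\<^sup>2 / (2 * \<sigma>\<^sup>2) \<le> \<eta>\<^sup>2 * \<sigma>\<^sup>2 - s\<^sup>2 / (4 * \<sigma>\<^sup>2)"
    by simp
  moreover have "\<eta> * norm y \<le> \<eta> * (norm \<mu> + s)"
    using assms norm_triangle_sub[of y \<mu>] by (intro mult_left_mono) (auto simp: s_def)
  ultimately have "\<eta> * norm y + (- s\<^sup>2 / (2 * \<sigma>\<^sup>2)) \<le> (\<eta>\<^sup>2 * \<sigma>\<^sup>2 + \<eta> * norm \<mu>) + (- s\<^sup>2 / (4 * \<sigma>\<^sup>2))"
    by (simp add: distrib_left)
  then have "exp (\<eta> * norm y) * exp (- s\<^sup>2 / (2 * \<sigma>\<^sup>2))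
      \<le> exp (\<eta>\<^sup>2 * \<sigma>\<^sup>2 + \<eta> * norm \<mu>) * exp (- s\<^sup>2 / (4 * \<sigma>\<^sup>2))"
    by (simp only: exp_add[symmetric] exp_le_cancel_iff)
  then have "Z * (exp (\<eta> * norm y) * exp (- s\<^sup>2 / (2 * \<sigma>\<^sup>2)))
      \<le> Z * (exp (\<eta>\<^sup>2 * \<sigma>\<^sup>2 + \<eta> * norm \<mu>) * exp (- s\<^sup>2 / (4 * \<sigma>\<^sup>2)))"
    by (rule mult_left_mono) (simp add: Z_def)
  also have "\<dots> = exp (\<eta>\<^sup>2 * \<sigma>\<^sup>2 + \<eta> * norm \<mu>) *
      (2 powr (real DIM('a) / 2) * gaussian_density \<mu> (sqrt 2 * \<sigma>) y)"
    by (simp only: density(2) mult.left_commute)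
  finally show ?thesis
    by (simp only: density(1) ac_simps)
qed

lemma nn_integral_exp_norm_gaussian_density_le:
  fixes \<mu> :: "'a::euclidean_space"
  assumes "0 < \<sigma>" "0 \<le> \<eta>"
  shows "(\<integral>\<^sup>+y. ennreal (exp (\<eta> * norm y) * gaussian_density \<mu> \<sigma> y) \<partial>lborel)
    \<le> ennreal (2 powr (real DIM('a) / 2) * exp (\<eta>\<^sup>2 * \<sigma>\<^sup>2 + \<eta> * norm \<mu>))"
proof -
  define c where "c = 2 powr (real DIM('a) / 2) * exp (\<eta>\<^sup>2 * \<sigma>\<^sup>2 + \<eta> * norm \<mu>)"
  have "(\<integral>\<^sup>+y. ennreal (exp (\<eta> * norm y) * gaussian_density \<mu> \<sigma> y) \<partial>lborel)
      \<le> (\<integral>\<^sup>+y. ennreal c * ennreal (gaussian_density \<mu> (sqrt 2 * \<sigma>) y) \<partial>lborel)"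
    using exp_norm_gaussian_density_le[OF assms, of _ \<mu>]
      gaussian_density_pos[of "sqrt 2 * \<sigma>" \<mu>] assms(1)
    by (intro nn_integral_mono) (simp add: c_def ennreal_mult'[symmetric] ennreal_leI)
  also have "\<dots> = ennreal c"
    using assms(1) nn_integral_gaussian_density[of "sqrt 2 * \<sigma>" \<mu>]
    by (simp add: nn_integral_cmult gaussian_density_def)
  finally show ?thesis
    by (simp add: c_def)
qed

section \<open>Exponential weights\<close>

definition exp_weight :: "real \<Rightarrow> 'a::real_normed_vector \<Rightarrow> real" where
  "exp_weight \<eta> x = exp (\<eta> * sqrt (1 + (norm x)\<^sup>2))"

lemma exp_weight_measurable [measurable]:
  "exp_weight \<eta> \<in> borel_measurable (borel :: 'a::euclidean_space measure)"
  unfolding exp_weight_def[abs_def] by measurable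

lemma exp_weight_ge_1: "0 \<le> \<eta> \<Longrightarrow> 1 \<le> exp_weight \<eta> x"
  by (simp add: exp_weight_def)

lemma exp_norm_le_exp_weight: "0 \<le> \<eta> \<Longrightarrow> exp (\<eta> * norm x) \<le> exp_weight \<eta> x"
  by (auto simp: exp_weight_def intro!: mult_left_mono real_le_rsqrt)

lemma exp_weight_le: "0 \<le> \<eta> \<Longrightarrow> exp_weight \<eta> x \<le> exp \<eta> * exp (\<eta> * norm x)"
proof -
  assume "0 \<le> \<eta>"
  moreover have "sqrt (1 + (norm x)\<^sup>2) \<le> 1 + norm x"
    by (rule real_le_lsqrt) (auto simp: power2_eq_square algebra_simps)
  ultimately have "\<eta> * sqrt (1 + (norm x)\<^sup>2) \<le> \<eta> * (1 + norm x)"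
    by (intro mult_left_mono)
  then show ?thesis
    by (simp add: exp_weight_def distrib_left flip: exp_add)
qed

lemma nn_integral_exp_neg_abs_finite:
  assumes "0 < l"
  shows "(\<integral>\<^sup>+t. ennreal (exp (- l * \<bar>t\<bar>)) \<partial>lborel) < \<infinity>"
proof -
  define E where "E = exponential_density l"
  have [measurable]: "E \<in> borel_measurable borel"
    by (simp add: E_def)
  interpret prob_space "density lborel E"
    unfolding E_def by (rule prob_space_exponential_density[OF assms])
  have mass: "(\<integral>\<^sup>+t. ennreal (E t) \<partial>lborel) = 1"
    using emeasure_space_1 by (simp add: emeasure_density)
  then have mass_reflected: "(\<integral>\<^sup>+t. ennreal (E (- t)) \<partial>lborel) = 1"
    using nn_integral_real_affine[of "\<lambda>t. ennreal (E t)" "-1" 0] by simp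
  have "(\<integral>\<^sup>+t. ennreal (l * exp (- l * \<bar>t\<bar>)) \<partial>lborel)
      \<le> (\<integral>\<^sup>+t. ennreal (E t) + ennreal (E (- t)) \<partial>lborel)"
    using assms
    by (intro nn_integral_mono)
      (auto simp: E_def exponential_density_def abs_if mult.commute ennreal_leI)
  also have "\<dots> = 2"
    by (simp add: nn_integral_add mass mass_reflected)
  finally have "ennreal l * (\<integral>\<^sup>+t. ennreal (exp (- l * \<bar>t\<bar>)) \<partial>lborel) \<le> 2"
    using assms by (simp add: ennreal_mult' nn_integral_cmult)
  then show ?thesis
    using assms by (auto simp: less_top[symmetric] ennreal_mult_top top_unique)
qed

lemma integrable_exp_neg_norm: "integrable lborel (\<lambda>x::'a::euclidean_space. exp (- norm x))"
proof (rule integrableI_nonneg)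
  define l where "l = 1 / real DIM('a)"
  have "(\<integral>\<^sup>+(x::'a). ennreal (exp (- norm x)) \<partial>lborel)
      \<le> (\<integral>\<^sup>+(x::'a). (\<Prod>b\<in>Basis. ennreal (exp (- l * \<bar>x \<bullet> b\<bar>))) \<partial>lborel)"
  proof (intro nn_integral_mono)
    fix x :: 'a
    have "(\<Sum>b\<in>Basis. \<bar>x \<bullet> b\<bar>) \<le> (\<Sum>b\<in>(Basis::'a set). norm x)"
      by (intro sum_mono Basis_le_norm)
    then have "l * (\<Sum>b\<in>Basis. \<bar>x \<bullet> b\<bar>) \<le> norm x"
      by (simp add: l_def field_simps)
    then have "exp (- norm x) \<le> (\<Prod>b\<in>Basis. exp (- l * \<bar>x \<bullet> b\<bar>))"
      by (simp add: exp_sum[symmetric] sum_negf sum_distrib_left)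
    then show "ennreal (exp (- norm x)) \<le> (\<Prod>b\<in>Basis. ennreal (exp (- l * \<bar>x \<bullet> b\<bar>)))"
      by (simp add: prod_ennreal ennreal_leI)
  qed
  also have "\<dots> = (\<Prod>b\<in>(Basis::'a set). \<integral>\<^sup>+t. ennreal (exp (- l * \<bar>t\<bar>)) \<partial>lborel)"
    by (rule nn_integral_lborel_prod) auto
  also have "\<dots> < \<infinity>"
    using nn_integral_exp_neg_abs_finite[of l] by (simp add: power_less_top_ennreal l_def)
  finally show "(\<integral>\<^sup>+(x::'a). ennreal (exp (- norm x)) \<partial>lborel) < \<infinity>" .
qed auto

lemma (in convex_tail_potential) exp_weight_integrable:
  assumes "0 \<le> \<eta>"
  shows "integrable lborel (\<lambda>x. exp_weight \<eta> x * exp (- U x))"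
proof -
  have [measurable]: "U \<in> borel_measurable borel"
    by (rule borel_measurable_continuous_onI[OF U_continuous])
  obtain C where C: "\<And>x. (\<eta> + 1) * norm x - C \<le> U x"
    using U_superlinear by blast
  have bound: "exp_weight \<eta> x * exp (- U x) \<le> exp (\<eta> + C) * exp (- norm x)" for x
  proof -
    have "exp_weight \<eta> x * exp (- U x) \<le> exp \<eta> * exp (\<eta> * norm x) * exp (- U x)"
      using exp_weight_le[OF assms] by (intro mult_right_mono) auto
    also have "\<dots> \<le> exp (\<eta> + C) * exp (- norm x)"
      using C[of x] by (simp add: algebra_simps flip: exp_add)
    finally show ?thesis .
  qed
  show ?thesis
  proof (rule Bochner_Integration.integrable_bound)
    show "integrable lborel (\<lambda>x::'a. exp (\<eta> + C) * exp (- norm x))"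
      using integrable_exp_neg_norm by simp
    show "AE x in lborel. norm (exp_weight \<eta> x * exp (- U x)) \<le> norm (exp (\<eta> + C) * exp (- norm x))"
      using bound by (simp add: exp_weight_def)
  qed measurable
qed

section \<open>The Metropolis-adjusted Langevin kernel\<close>

lemma prop_dens_eq_gaussian_density:
  "0 < \<gamma> \<Longrightarrow> prop_dens g \<gamma> x = gaussian_density (gradient_step g \<gamma> x) (sqrt (2 * \<gamma>))"
  by (auto simp: prop_dens_def gaussian_density_def gradient_step_def algebra_simps)

lemma nn_integral_prop_dens_exp_weight_le:
  fixes x :: "'a::euclidean_space"
  assumes \<gamma>: "0 < \<gamma>" and \<eta>: "0 \<le> \<eta>"
  shows "(\<integral>\<^sup>+y. ennreal (prop_dens g \<gamma> x y) * ennreal (exp_weight \<eta> y) \<partial>lborel)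
    \<le> ennreal (2 powr (real DIM('a) / 2) * exp (\<eta> + 2 * \<gamma> * \<eta>\<^sup>2)
        * exp (\<eta> * norm (gradient_step g \<gamma> x)))"
proof -
  have "(\<integral>\<^sup>+y. ennreal (prop_dens g \<gamma> x y) * ennreal (exp_weight \<eta> y) \<partial>lborel)
      \<le> (\<integral>\<^sup>+y. ennreal (exp \<eta>) * ennreal (exp (\<eta> * norm y) * prop_dens g \<gamma> x y) \<partial>lborel)"
  proof (intro nn_integral_mono)
    fix y
    have nonneg: "0 \<le> prop_dens g \<gamma> x y"
      by (simp add: prop_dens_def)
    have "prop_dens g \<gamma> x y * exp_weight \<eta> y \<le> exp \<eta> * (exp (\<eta> * norm y) * prop_dens g \<gamma> x y)"
      using mult_left_mono[OF exp_weight_le[OF \<eta>, of y] nonneg] by (simp add: ac_simps)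
    with nonneg show "ennreal (prop_dens g \<gamma> x y) * ennreal (exp_weight \<eta> y)
        \<le> ennreal (exp \<eta>) * ennreal (exp (\<eta> * norm y) * prop_dens g \<gamma> x y)"
      by (simp add: ennreal_leI flip: ennreal_mult')
  qed
  also have "\<dots> = ennreal (exp \<eta>) * (\<integral>\<^sup>+y. ennreal (exp (\<eta> * norm y) * prop_dens g \<gamma> x y) \<partial>lborel)"
    by (intro nn_integral_cmult) (simp add: prop_dens_def)
  also have "\<dots> \<le> ennreal (exp \<eta>) * ennreal (2 powr (real DIM('a) / 2) *
      exp (\<eta>\<^sup>2 * (sqrt (2 * \<gamma>))\<^sup>2 + \<eta> * norm (gradient_step g \<gamma> x)))"
    unfolding prop_dens_eq_gaussian_density[OF \<gamma>] using \<gamma> \<eta>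
    by (intro mult_left_mono nn_integral_exp_norm_gaussian_density_le) auto
  also have "\<dots> = ennreal (2 powr (real DIM('a) / 2) * exp (\<eta> + 2 * \<gamma> * \<eta>\<^sup>2)
        * exp (\<eta> * norm (gradient_step g \<gamma> x)))"
    using \<gamma> by (simp add: exp_add ac_simps flip: ennreal_mult')
  finally show ?thesis .
qed

definition log_accept_ratio :: "('a::real_inner \<Rightarrow> real) \<Rightarrow> ('a \<Rightarrow> 'a) \<Rightarrow> real \<Rightarrow> 'a \<Rightarrow> 'a \<Rightarrow> real" where
  "log_accept_ratio U g \<gamma> x y = U x - U y
     + ((norm (y - gradient_step g \<gamma> x))\<^sup>2 - (norm (x - gradient_step g \<gamma> y))\<^sup>2) / (4 * \<gamma>)"

text \<open>The trapezoidal error of \<open>U\<close> along \<open>[x, y]\<close>, which has no sign, combines with the drift into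
  the Taylor remainder at \<open>y\<close>, which convexity makes nonnegative.\<close>

lemma log_accept_ratio_eq:
  assumes "0 < \<gamma>"
  shows "log_accept_ratio U g \<gamma> x y = (U x - U y + g y \<bullet> (y - x))
    - (y - gradient_step g \<gamma> x) \<bullet> (g y - g x) / 2 - \<gamma> / 4 * (norm (g y - g x))\<^sup>2"
proof -
  have "(norm (y - gradient_step g \<gamma> x))\<^sup>2 - (norm (x - gradient_step g \<gamma> y))\<^sup>2
      = 4 * \<gamma> * (g y \<bullet> (y - x) - (y - gradient_step g \<gamma> x) \<bullet> (g y - g x) / 2
        - \<gamma> / 4 * (norm (g y - g x))\<^sup>2)"
    unfolding power2_norm_eq_inner gradient_step_def
    by (simp add: inner_simps inner_commute field_simps)
  then show ?thesis
    using assms by (simp add: log_accept_ratio_def field_simps)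
qed

lemma log_accept_ratio_ge:
  assumes \<gamma>: "0 < \<gamma>" and w: "(norm (y - gradient_step g \<gamma> x))\<^sup>2 \<le> 2 * \<gamma>"
    and remainder: "\<gamma> * (norm (g y - g x))\<^sup>2 \<le> 2 * (U x - U y + g y \<bullet> (y - x))"
  shows "- 1/2 \<le> log_accept_ratio U g \<gamma> x y"
proof -
  define w where "w = y - gradient_step g \<gamma> x"
  define d where "d = g y - g x"
  have "0 \<le> (norm (w - \<gamma> *\<^sub>R d))\<^sup>2"
    by simp
  also have "\<dots> = (norm w)\<^sup>2 - 2 * \<gamma> * (w \<bullet> d) + \<gamma>\<^sup>2 * (norm d)\<^sup>2"
    unfolding power2_norm_eq_inner by (simp add: inner_simps inner_commute power2_eq_square)
  also have "\<dots> \<le> 2 * \<gamma> - 2 * \<gamma> * (w \<bullet> d) + \<gamma>\<^sup>2 * (norm d)\<^sup>2"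
    using w by (simp add: w_def)
  also have "\<dots> = 4 * \<gamma> * (1/2 + \<gamma> / 4 * (norm d)\<^sup>2 - w \<bullet> d / 2)"
    by (simp add: algebra_simps power2_eq_square)
  finally have "w \<bullet> d / 2 \<le> 1/2 + \<gamma> / 4 * (norm d)\<^sup>2"
    using \<gamma> by (simp add: zero_le_mult_iff)
  moreover have "\<gamma> * (norm d)\<^sup>2 \<le> 2 * (U x - U y + g y \<bullet> (y - x))"
    using remainder by (simp only: d_def)
  ultimately show ?thesis
    unfolding log_accept_ratio_eq[OF \<gamma>] w_def[symmetric] d_def[symmetric]
    by (simp add: field_simps)
qed

locale mala =
  fixes U :: "'a::euclidean_space \<Rightarrow> real" and gU :: "'a \<Rightarrow> 'a" and \<gamma> :: real
  assumes U_cont: "continuous_on UNIV U" and gU_cont: "continuous_on UNIV gU"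
    and integrable_exp_neg_U: "integrable lborel (\<lambda>x. exp (- U x))"
    and \<gamma>_pos: "0 < \<gamma>"
begin

lemma U_measurable [measurable]: "U \<in> borel_measurable borel"
  by (rule borel_measurable_continuous_onI[OF U_cont])

lemma gU_measurable [measurable]: "gU \<in> borel_measurable borel"
  by (rule borel_measurable_continuous_onI[OF gU_cont])

lemma norm_const_pos: "0 < norm_const U"
proof -
  have "\<not> (AE x :: 'a in lborel. False)"
    by (simp add: ae_filter_eq_bot_iff eventually_False)
  then have "(\<integral>x. exp (- U x) \<partial>lborel) \<noteq> 0"
    using integral_nonneg_eq_0_iff_AE[OF integrable_exp_neg_U] by simp
  moreover have "0 \<le> (\<integral>x. exp (- U x) \<partial>lborel)"
    by (simp add: integral_nonneg_AE)
  ultimately show ?thesis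
    unfolding norm_const_def by linarith
qed

lemma pi_dens_pos: "0 < pi_dens U x"
  using norm_const_pos by (simp add: pi_dens_def)

lemma pi_dens_measurable [measurable]: "pi_dens U \<in> borel_measurable borel"
  unfolding pi_dens_def[abs_def] by measurable

lemma prop_dens_pos: "0 < prop_dens gU \<gamma> x y"
  using \<gamma>_pos by (simp add: prop_dens_def)

lemma accept_eq: "accept U gU \<gamma> x y = min 1 (exp (log_accept_ratio U gU \<gamma> x y))"
proof -
  have cancel: "(a / Z * (c * b)) / (a' / Z * (c * b')) = (a * b) / (a' * b')"
    if "Z \<noteq> 0" "c \<noteq> 0" for a b a' b' c Z :: real
    using that by simp
  show ?thesis
    unfolding accept_def pi_dens_def prop_dens_def log_accept_ratio_def gradient_step_def
    using norm_const_pos \<gamma>_pos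
    by (subst cancel)
      (auto simp: diff_divide_distrib algebra_simps simp flip: exp_add exp_diff)
qed

lemma prop_dens_measurable:
  "(\<lambda>(x, y). prop_dens gU \<gamma> x y) \<in> borel_measurable (borel \<Otimes>\<^sub>M borel)"
  unfolding prop_dens_def by measurable

lemma accept_measurable:
  "(\<lambda>(x, y). accept U gU \<gamma> x y) \<in> borel_measurable (borel \<Otimes>\<^sub>M borel)"
  unfolding accept_eq log_accept_ratio_def gradient_step_def by measurable

sublocale metropolis_hastings lborel "accept U gU \<gamma>" "prop_dens gU \<gamma>"
proof
  show "(\<integral>\<^sup>+y. ennreal (prop_dens gU \<gamma> x y) \<partial>lborel) = 1" for x
    using \<gamma>_pos by (simp add: prop_dens_eq_gaussian_density nn_integral_gaussian_density)
  show "0 \<le> accept U gU \<gamma> x y" "accept U gU \<gamma> x y \<le> 1" for x y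
    by (simp_all add: accept_eq)
  show "0 \<le> prop_dens gU \<gamma> x y" for x y
    using prop_dens_pos by (rule order_less_imp_le)
  show "case_prod (accept U gU \<gamma>) \<in> borel_measurable (lborel \<Otimes>\<^sub>M lborel)"
    "case_prod (prop_dens gU \<gamma>) \<in> borel_measurable (lborel \<Otimes>\<^sub>M lborel)"
    using accept_measurable prop_dens_measurable by simp_all
qed

lemma MALA_eq_mh_kernel: "MALA U gU \<gamma> = P"
  by (simp add: fun_eq_iff MALA_def mh_kernel_def)

lemma kernel_iter_eq_MALA_iter: "kernel_iter lborel P k x = MALA_iter U gU \<gamma> k x"
  by (induction k) (auto simp: MALA_eq_mh_kernel cong: return_cong)

lemma prob_space_pi_meas: "prob_space (pi_meas U)"
proof (rule prob_spaceI)
  have "(\<integral>\<^sup>+x. ennreal (pi_dens U x) \<partial>lborel) = ennreal (\<integral>x. pi_dens U x \<partial>lborel)"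
    using integrable_exp_neg_U norm_const_pos
    by (intro nn_integral_eq_integral) (auto simp: pi_dens_def)
  also have "\<dots> = 1"
    using norm_const_pos by (simp add: pi_dens_def norm_const_def)
  finally show "emeasure (pi_meas U) (space (pi_meas U)) = 1"
    by (simp add: pi_meas_def emeasure_density pi_dens_def)
qed

lemma detailed_balance:
  "pi_dens U x * (accept U gU \<gamma> x y * prop_dens gU \<gamma> x y)
    = pi_dens U y * (accept U gU \<gamma> y x * prop_dens gU \<gamma> y x)"
proof -
  have "pi_dens U x * (accept U gU \<gamma> x y * prop_dens gU \<gamma> x y)
      = min (pi_dens U x * prop_dens gU \<gamma> x y) (pi_dens U y * prop_dens gU \<gamma> y x)" for x y
    using pi_dens_pos[of x] prop_dens_pos[of x y] by (simp add: accept_def min_def field_simps)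
  then show ?thesis
    by (metis min.commute)
qed

lemma pi_meas_invariant: "pi_meas U \<bind> P = pi_meas U"
  unfolding pi_meas_def
proof (rule density_invariant)
  show "(\<lambda>x. ennreal (pi_dens U x)) \<in> borel_measurable lborel"
    by measurable
  show "ennreal (pi_dens U x) * ennreal (accept U gU \<gamma> x y * prop_dens gU \<gamma> x y)
      = ennreal (pi_dens U y) * ennreal (accept U gU \<gamma> y x * prop_dens gU \<gamma> y x)" for x y
    using pi_dens_pos detailed_balance[of x y] by (simp add: order_less_imp_le flip: ennreal_mult')
qed simp

lemma minorization_on_compact:
  assumes "compact S"
  obtains \<epsilon> where "0 < \<epsilon>"
    "\<And>x. x \<in> S \<Longrightarrow> scale_measure (ennreal \<epsilon>) (uniform_measure lborel (cball 0 1)) \<le> P x"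
proof (cases "S = {}")
  case False
  define k where "k z = accept U gU \<gamma> (fst z) (snd z) * prop_dens gU \<gamma> (fst z) (snd z)" for z
  have "continuous_on UNIV k"
    unfolding k_def accept_eq log_accept_ratio_def gradient_step_def prop_dens_def using \<gamma>_pos
    by (intro continuous_intros continuous_on_compose2[OF U_cont]
        continuous_on_compose2[OF gU_cont]) auto
  moreover have "compact (S \<times> cball (0::'a) 1)" "S \<times> cball (0::'a) 1 \<noteq> {}"
    using \<open>compact S\<close> False by (auto intro: compact_Times)
  ultimately obtain z where z: "\<And>p. p \<in> S \<times> cball 0 1 \<Longrightarrow> k z \<le> k p"
    using continuous_attains_inf[OF _ _ continuous_on_subset[OF _ subset_UNIV]] by metis
  have "0 < k z"
    using prop_dens_pos by (simp add: k_def accept_eq)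
  moreover define v where "v = measure lborel (cball (0::'a) 1)"
  then have v: "emeasure lborel (cball (0::'a) 1) = ennreal v" "0 < v"
    by (auto simp: emeasure_eq_ennreal_measure emeasure_cball)
  have "scale_measure (ennreal (k z * v)) (uniform_measure lborel (cball 0 1)) \<le> P x"
    if "x \<in> S" for x
    using minorization[of "cball 0 1" x "k z"] z[of "(x, _)"] that v \<open>0 < k z\<close>
    by (simp add: k_def ennreal_mult')
  ultimately show thesis
    using that[of "k z * v"] v by simp
qed (use that[of 1] in simp)

lemma minorization_on_level_set:
  assumes "0 < \<eta>"
  obtains \<epsilon> where "0 < \<epsilon>"
    "\<And>x. exp_weight \<eta> x \<le> S \<Longrightarrow> scale_measure (ennreal \<epsilon>) (uniform_measure lborel (cball 0 1)) \<le> P x"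
proof -
  have level: "x \<in> cball 0 (S / \<eta>)" if "exp_weight \<eta> x \<le> S" for x :: 'a
  proof -
    have "\<eta> * norm x \<le> exp (\<eta> * norm x)"
      using exp_ge_add_one_self[of "\<eta> * norm x"] by linarith
    also have "\<dots> \<le> S"
      using assms that by (intro order_trans[OF exp_norm_le_exp_weight]) auto
    finally show ?thesis
      using assms by (simp add: field_simps)
  qed
  obtain \<epsilon> where "0 < \<epsilon>" "\<And>x. x \<in> cball 0 (S / \<eta>) \<Longrightarrow>
      scale_measure (ennreal \<epsilon>) (uniform_measure lborel (cball 0 1)) \<le> P x"
    using minorization_on_compact[OF compact_cball] by blast
  then show thesis
    using that level by blast
qed

end

section \<open>Geometric ergodicity\<close>

lemma Vnorm_le:
  assumes "\<And>f. f \<in> borel_measurable borel \<Longrightarrow> (\<And>x. \<bar>f x\<bar> \<le> V x) \<Longrightarrow> \<bar>(\<integral>x. f x \<partial>M) - (\<integral>x. f x \<partial>N)\<bar> \<le> c"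
  shows "Vnorm M N V \<le> ereal c"
  unfolding Vnorm_def using assms by (intro SUP_least) auto

lemma prob_space_uniform_cball:
  fixes c :: "'a::euclidean_space"
  assumes "0 < r"
  shows "prob_space (uniform_measure lborel (cball c r))"
proof -
  have "unit_ball_vol (real DIM('a)) \<noteq> 0"
    by (simp add: less_imp_neq[symmetric])
  then show ?thesis
    using assms by (intro prob_space_uniform_measure) (auto simp: emeasure_cball)
qed

locale mala_convex_tail = convex_tail_potential +
  fixes \<gamma> \<eta> :: real
  assumes step_pos: "0 < \<gamma>" and step_lipschitz: "\<gamma> * L \<le> 1/4" and step_curvature: "\<gamma> * A \<le> 1"
    and \<eta>_pos: "0 < \<eta>"
begin

sublocale mala U gU \<gamma>
  using exp_weight_integrable[of 0]
  by unfold_locales (auto simp: exp_weight_def intro: U_continuous gU_continuous step_pos)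

lemma accept_ge:
  assumes y: "(norm (y - gradient_step gU \<gamma> x))\<^sup>2 \<le> 2 * \<gamma>"
    and x: "2 * K \<le> norm x" "4 * sqrt (2 * \<gamma>) \<le> norm x"
  shows "exp (- 1/2) \<le> accept U gU \<gamma> x y"
proof -
  have "norm (y - gradient_step gU \<gamma> x) \<le> norm x / 4"
    using real_le_rsqrt[OF y] x(2) by simp
  then have "2 * norm (y - x) \<le> norm x"
    using step_pos step_lipschitz by (intro norm_proposal_diff_le) auto
  then have "- 1/2 \<le> log_accept_ratio U gU \<gamma> x y"
    using step_pos step_curvature x(1)
    by (intro log_accept_ratio_ge y gradient_diff_sq_le_taylor_remainder) auto
  then show ?thesis
    by (simp add: accept_eq)
qed

lemma accepted_density_ge:
  assumes y: "(norm (y - gradient_step gU \<gamma> x))\<^sup>2 \<le> 2 * \<gamma>"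
    and x: "2 * K \<le> norm x" "4 * sqrt (2 * \<gamma>) \<le> norm x"
  shows "exp (- 1/2) * ((4 * pi * \<gamma>) powr (- real DIM('a) / 2) * exp (- 1/2))
    \<le> accept U gU \<gamma> x y * prop_dens gU \<gamma> x y"
proof (intro mult_mono accept_ge[OF assms])
  show "(4 * pi * \<gamma>) powr (- real DIM('a) / 2) * exp (- 1/2) \<le> prop_dens gU \<gamma> x y"
    using y step_pos
    by (auto simp: prop_dens_def gradient_step_def algebra_simps divide_simps
        intro!: mult_left_mono)
qed (auto simp: acceptance_nonneg)

lemma eventually_acc_prob_ge:
  obtains p where "0 < p" "p \<le> 1" "\<forall>\<^sub>F x in at_infinity. ennreal p \<le> acc_prob x"
proof -
  define \<delta> where "\<delta> = exp (- 1/2) * ((4 * pi * \<gamma>) powr (- real DIM('a) / 2) * exp (- 1/2))"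
  define v where "v = unit_ball_vol (real DIM('a)) * sqrt (2 * \<gamma>) ^ DIM('a)"
  define p where "p = min 1 (\<delta> * v)"
  have pos: "0 < \<delta>" "0 < v"
    using step_pos by (simp_all add: \<delta>_def v_def)
  have "ennreal p \<le> acc_prob x" if x: "2 * K + 4 * sqrt (2 * \<gamma>) \<le> norm x" for x
  proof -
    have "\<delta> \<le> accept U gU \<gamma> x y * prop_dens gU \<gamma> x y"
      if "y \<in> cball (gradient_step gU \<gamma> x) (sqrt (2 * \<gamma>))" for y
      unfolding \<delta>_def
    proof (rule accepted_density_ge)
      show "(norm (y - gradient_step gU \<gamma> x))\<^sup>2 \<le> 2 * \<gamma>"
        using that step_pos by (simp add: dist_norm norm_minus_commute sqrt_ge_absD)
      have "0 \<le> sqrt (2 * \<gamma>)"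
        using step_pos by simp
      then show "2 * K \<le> norm x" "4 * sqrt (2 * \<gamma>) \<le> norm x"
        using x K_nonneg by linarith+
    qed
    then have "ennreal \<delta> * emeasure lborel (cball (gradient_step gU \<gamma> x) (sqrt (2 * \<gamma>)))
        \<le> acc_prob x"
      by (intro acc_prob_ge) auto
    moreover have "emeasure lborel (cball (gradient_step gU \<gamma> x) (sqrt (2 * \<gamma>))) = ennreal v"
      unfolding v_def using step_pos by (intro emeasure_cball) auto
    moreover have "ennreal p \<le> ennreal \<delta> * ennreal v"
      using pos by (simp add: p_def ennreal_leI flip: ennreal_mult')
    ultimately show ?thesis
      by simp
  qed
  then have "\<forall>\<^sub>F x in at_infinity. ennreal p \<le> acc_prob x"
    by (auto simp: eventually_at_infinity)
  then show thesis
    using that[of p] pos by (simp add: p_def)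
qed

definition moment_bound :: real where
  "moment_bound = 2 powr (real DIM('a) / 2) * exp (\<eta> + 2 * \<gamma> * \<eta>\<^sup>2)"

lemma moment_bound_pos: "0 < moment_bound"
  by (simp add: moment_bound_def)

lemma nn_integral_weight_le:
  assumes "rej_prob x \<le> ennreal c" "0 \<le> c"
  shows "(\<integral>\<^sup>+y. ennreal (exp_weight \<eta> y) \<partial>P x)
    \<le> ennreal (moment_bound * exp (\<eta> * norm (gradient_step gU \<gamma> x)) + c * exp_weight \<eta> x)"
proof -
  have "(\<integral>\<^sup>+y. ennreal (exp_weight \<eta> y) \<partial>P x)
      \<le> (\<integral>\<^sup>+y. ennreal (prop_dens gU \<gamma> x y) * ennreal (exp_weight \<eta> y) \<partial>lborel)
        + rej_prob x * ennreal (exp_weight \<eta> x)"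
    by (rule nn_integral_mh_kernel_le) auto
  also have "\<dots> \<le> ennreal (moment_bound * exp (\<eta> * norm (gradient_step gU \<gamma> x)))
      + ennreal c * ennreal (exp_weight \<eta> x)"
    unfolding moment_bound_def using step_pos \<eta>_pos
    by (intro add_mono nn_integral_prop_dens_exp_weight_le mult_right_mono assms(1)) auto
  also have "\<dots> = ennreal (moment_bound * exp (\<eta> * norm (gradient_step gU \<gamma> x))
      + c * exp_weight \<eta> x)"
    using assms(2) moment_bound_pos by (simp add: exp_weight_def ennreal_mult' ennreal_plus)
  finally show ?thesis .
qed

lemma eventually_weight_contracts:
  obtains \<alpha> where "0 \<le> \<alpha>" "\<alpha> < 1"
    "\<forall>\<^sub>F x in at_infinity. (\<integral>\<^sup>+y. ennreal (exp_weight \<eta> y) \<partial>P x) \<le> ennreal (\<alpha> * exp_weight \<eta> x)"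
proof -
  obtain p where p: "0 < p" "p \<le> 1" "\<forall>\<^sub>F x in at_infinity. ennreal p \<le> acc_prob x"
    by (rule eventually_acc_prob_ge)
  define B where "B = ln (2 * moment_bound / p) / \<eta>"
  have B: "moment_bound * exp (- (\<eta> * B)) = p / 2"
    using p moment_bound_pos \<eta>_pos by (simp add: B_def exp_minus)
  have "\<gamma> * L \<le> 1"
    using step_lipschitz by simp
  then have "\<forall>\<^sub>F x in at_infinity. B \<le> norm x - norm (gradient_step gU \<gamma> x)"
    using gradient_step_gain[OF step_pos] by (simp add: filterlim_at_top)
  with p(3) have "\<forall>\<^sub>F x in at_infinity.
    (\<integral>\<^sup>+y. ennreal (exp_weight \<eta> y) \<partial>P x) \<le> ennreal ((1 - p / 2) * exp_weight \<eta> x)"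
  proof eventually_elim
    case (elim x)
    have "\<eta> * norm (gradient_step gU \<gamma> x) \<le> \<eta> * (norm x - B)"
      using elim(2) \<eta>_pos by (intro mult_left_mono) auto
    then have "exp (\<eta> * norm (gradient_step gU \<gamma> x)) \<le> exp (- (\<eta> * B)) * exp (\<eta> * norm x)"
      by (simp add: algebra_simps flip: exp_add)
    then have "moment_bound * exp (\<eta> * norm (gradient_step gU \<gamma> x))
        \<le> moment_bound * (exp (- (\<eta> * B)) * exp (\<eta> * norm x))"
      using moment_bound_pos by (intro mult_left_mono) auto
    also have "\<dots> = p / 2 * exp (\<eta> * norm x)"
      by (simp flip: B)
    also have "\<dots> \<le> p / 2 * exp_weight \<eta> x"
      using p \<eta>_pos by (intro mult_left_mono exp_norm_le_exp_weight) auto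
    finally have "moment_bound * exp (\<eta> * norm (gradient_step gU \<gamma> x)) + (1 - p) * exp_weight \<eta> x
        \<le> (1 - p / 2) * exp_weight \<eta> x"
      by (simp add: algebra_simps)
    moreover have "rej_prob x \<le> ennreal (1 - p)"
      using elim(1) p(1) by (intro rej_prob_le) auto
    ultimately show ?case
      using p(2) by (intro order_trans[OF nn_integral_weight_le] ennreal_leI) auto
  qed
  then show thesis
    using that[of "1 - p / 2"] p by simp
qed

lemma nn_integral_weight_locally_bounded:
  assumes "norm x \<le> R"
  shows "(\<integral>\<^sup>+y. ennreal (exp_weight \<eta> y) \<partial>P x)
    \<le> ennreal (moment_bound * exp (\<eta> * (2 * R)) + exp \<eta> * exp (\<eta> * R))"
proof -
  have "norm (gradient_step gU \<gamma> x) \<le> norm x + \<gamma> * norm (gU x)"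
    unfolding gradient_step_def using norm_triangle_ineq4[of x "\<gamma> *\<^sub>R gU x"] step_pos by simp
  also have "\<gamma> * norm (gU x) \<le> (\<gamma> * L) * norm x"
    using norm_grad_le[of x] step_pos by (simp add: mult.assoc)
  also have "(\<gamma> * L) * norm x \<le> 1 * norm x"
    using step_lipschitz by (intro mult_right_mono) auto
  finally have "norm (gradient_step gU \<gamma> x) \<le> 2 * R"
    using assms by simp
  then have step: "moment_bound * exp (\<eta> * norm (gradient_step gU \<gamma> x))
      \<le> moment_bound * exp (\<eta> * (2 * R))"
    using \<eta>_pos moment_bound_pos by (intro mult_left_mono) auto
  have "exp_weight \<eta> x \<le> exp \<eta> * exp (\<eta> * norm x)"
    using \<eta>_pos by (intro exp_weight_le) auto
  also have "\<dots> \<le> exp \<eta> * exp (\<eta> * R)"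
    using assms \<eta>_pos by (intro mult_left_mono) auto
  finally have weight: "exp_weight \<eta> x \<le> exp \<eta> * exp (\<eta> * R)" .
  have "rej_prob x \<le> ennreal 1"
    using rej_prob_le[of x 0] by simp
  then show ?thesis
    using step weight by (intro order_trans[OF nn_integral_weight_le[of x 1]] ennreal_leI) auto
qed

lemma weight_drift:
  obtains \<alpha> b where "0 \<le> \<alpha>" "\<alpha> < 1" "0 \<le> b"
    "\<And>x. (\<integral>\<^sup>+y. ennreal (exp_weight \<eta> y) \<partial>P x) \<le> ennreal (\<alpha> * exp_weight \<eta> x + b)"
proof -
  obtain \<alpha> where \<alpha>: "0 \<le> \<alpha>" "\<alpha> < 1" and
    "\<forall>\<^sub>F x in at_infinity. (\<integral>\<^sup>+y. ennreal (exp_weight \<eta> y) \<partial>P x) \<le> ennreal (\<alpha> * exp_weight \<eta> x)"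
    by (rule eventually_weight_contracts)
  then obtain R where far: "\<And>x. R \<le> norm x \<Longrightarrow>
      (\<integral>\<^sup>+y. ennreal (exp_weight \<eta> y) \<partial>P x) \<le> ennreal (\<alpha> * exp_weight \<eta> x)"
    by (auto simp: eventually_at_infinity)
  define b where "b = moment_bound * exp (\<eta> * (2 * R)) + exp \<eta> * exp (\<eta> * R)"
  have b: "0 \<le> b"
    using moment_bound_pos by (simp add: b_def)
  have "(\<integral>\<^sup>+y. ennreal (exp_weight \<eta> y) \<partial>P x) \<le> ennreal (\<alpha> * exp_weight \<eta> x + b)" for x
  proof (cases "R \<le> norm x")
    case True
    then show ?thesis
      using b by (intro order_trans[OF far] ennreal_leI) auto
  next
    case False
    then have "(\<integral>\<^sup>+y. ennreal (exp_weight \<eta> y) \<partial>P x) \<le> ennreal b"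
      unfolding b_def by (intro nn_integral_weight_locally_bounded) simp
    also have "\<dots> \<le> ennreal (\<alpha> * exp_weight \<eta> x + b)"
      using \<alpha> by (intro ennreal_leI) (simp add: exp_weight_def)
    finally show ?thesis .
  qed
  then show thesis
    using that \<alpha> b by blast
qed

lemma weight_integrable_pi_meas: "integrable (pi_meas U) (exp_weight \<eta>)"
proof -
  have "integrable lborel (\<lambda>x. exp_weight \<eta> x * exp (- U x) / norm_const U)"
    using exp_weight_integrable[of \<eta>] \<eta>_pos by simp
  then show ?thesis
    unfolding pi_meas_def using pi_dens_pos
    by (subst integrable_density) (auto simp: order_less_imp_le pi_dens_def mult.commute)
qed

theorem mala_geometric_ergodicity:
  obtains C \<rho> where "0 \<le> C" "0 \<le> \<rho>" "\<rho> < 1"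
    "\<And>x k. Vnorm (MALA_iter U gU \<gamma> k x) (pi_meas U) (exp_weight \<eta>)
      \<le> ereal (C * \<rho> ^ k * exp_weight \<eta> x)"
proof -
  obtain \<alpha> b where "0 \<le> \<alpha>" "\<alpha> < 1" "0 \<le> b"
    and "\<And>x. (\<integral>\<^sup>+y. ennreal (exp_weight \<eta> y) \<partial>P x) \<le> ennreal (\<alpha> * exp_weight \<eta> x + b)"
    using weight_drift by blast
  then interpret drift_kernel lborel P "exp_weight \<eta>" \<alpha> b
    using \<eta>_pos mh_kernel_measurable by unfold_locales (auto intro: exp_weight_ge_1)
  define S where "S = (2 * b + 1) / (1 - \<alpha>)"
  have S: "2 * b < (1 - \<alpha>) * S"
    using rate by (simp add: S_def)
  obtain \<epsilon> where \<epsilon>: "0 < \<epsilon>" "\<And>x. exp_weight \<eta> x \<le> S \<Longrightarrow>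
      scale_measure (ennreal \<epsilon>) (uniform_measure lborel (cball 0 1)) \<le> P x"
    using minorization_on_level_set[OF \<eta>_pos] by blast
  have admissible_pi: "admissible (pi_meas U)"
    using prob_space_pi_meas weight_integrable_pi_meas by (simp add: admissible_def pi_meas_def)
  show thesis
  proof (rule harris[OF S \<epsilon>(1) prob_space_uniform_cball _ \<epsilon>(2) admissible_pi pi_meas_invariant])
    fix C \<rho> :: real
    assume C: "0 \<le> C" "0 \<le> \<rho>" "\<rho> < 1"
      and bound: "\<And>f x k. f \<in> borel_measurable lborel \<Longrightarrow>
        (\<And>x. x \<in> space lborel \<Longrightarrow> \<bar>f x\<bar> \<le> exp_weight \<eta> x) \<Longrightarrow> x \<in> space lborel \<Longrightarrow>
        \<bar>(\<integral>y. f y \<partial>kernel_iter lborel P k x) - (\<integral>y. f y \<partial>pi_meas U)\<bar> \<le> C * \<rho> ^ k * exp_weight \<eta> x"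
    have "Vnorm (MALA_iter U gU \<gamma> k x) (pi_meas U) (exp_weight \<eta>)
        \<le> ereal (C * \<rho> ^ k * exp_weight \<eta> x)" for x k
      unfolding kernel_iter_eq_MALA_iter[symmetric] by (intro Vnorm_le bound) auto
    with C show thesis
      by (rule that)
  qed simp_all
qed

end

theorem (in convex_tail_potential) mala_geometric_ergodicity_small_step:
  assumes "0 < \<eta>"
  shows "\<exists>\<Gamma>>0. \<forall>\<gamma>. 0 < \<gamma> \<and> \<gamma> \<le> \<Gamma> \<longrightarrow> (\<exists>C \<rho>. 0 \<le> C \<and> 0 \<le> \<rho> \<and> \<rho> < 1 \<and>
    (\<forall>x k. Vnorm (MALA_iter U gU \<gamma> k x) (pi_meas U) (exp_weight \<eta>)
      \<le> ereal (C * \<rho> ^ k * exp_weight \<eta> x)))"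
proof -
  define \<Gamma> where "\<Gamma> = 1 / (4 * \<bar>L\<bar> + \<bar>A\<bar> + 1)"
  have "0 < \<Gamma>"
    by (simp add: \<Gamma>_def add_nonneg_pos)
  moreover have "\<exists>C \<rho>. 0 \<le> C \<and> 0 \<le> \<rho> \<and> \<rho> < 1 \<and>
      (\<forall>x k. Vnorm (MALA_iter U gU \<gamma> k x) (pi_meas U) (exp_weight \<eta>)
        \<le> ereal (C * \<rho> ^ k * exp_weight \<eta> x))"
    if \<gamma>: "0 < \<gamma>" "\<gamma> \<le> \<Gamma>" for \<gamma>
  proof -
    have "\<gamma> * (4 * \<bar>L\<bar> + \<bar>A\<bar> + 1) \<le> \<Gamma> * (4 * \<bar>L\<bar> + \<bar>A\<bar> + 1)"
      using \<gamma>(2) by (intro mult_right_mono) auto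
    also have "\<dots> = 1"
      using \<open>0 < \<Gamma>\<close> by (simp add: \<Gamma>_def)
    finally have "4 * (\<gamma> * \<bar>L\<bar>) + \<gamma> * \<bar>A\<bar> + \<gamma> \<le> 1"
      by (simp add: algebra_simps)
    moreover have "\<gamma> * L \<le> \<gamma> * \<bar>L\<bar>" "0 \<le> \<gamma> * \<bar>L\<bar>" "\<gamma> * A \<le> \<gamma> * \<bar>A\<bar>" "0 \<le> \<gamma> * \<bar>A\<bar>"
      using \<gamma>(1) by (simp_all add: mult_left_mono)
    ultimately have "\<gamma> * L \<le> 1/4" "\<gamma> * A \<le> 1"
      using \<gamma>(1) by linarith+
    then interpret mala_convex_tail U gU HU \<kappa> \<Lambda> L K A \<gamma> \<eta>
      using assms \<gamma>(1) by unfold_locales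
    show ?thesis
      by (rule mala_geometric_ergodicity) blast
  qed
  ultimately show ?thesis
    by blast
qed

section \<open>Polynomially decaying curvature\<close>

lemma rpow_nonneg: "0 \<le> rpow t a"
  by (simp add: rpow_def)

lemma rpow_mono: "0 \<le> s \<Longrightarrow> s \<le> t \<Longrightarrow> 0 \<le> a \<Longrightarrow> rpow s a \<le> rpow t a"
  by (auto simp: rpow_def powr_mono2)

lemma rpow_add: "0 \<le> a \<Longrightarrow> 0 \<le> b \<Longrightarrow> rpow t (a + b) = rpow t a * rpow t b"
  by (auto simp: rpow_def powr_add)

lemma rpow_curvature_growth:
  assumes "0 \<le> \<beta>" "\<beta> < 1" "0 < m"
  shows "filterlim (\<lambda>r. r * (m / (1 + rpow r \<beta>))) at_top at_top"
proof (rule filterlim_at_top_mono)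
  show "filterlim (\<lambda>r. m / 2 * r powr (1 - \<beta>)) at_top at_top"
    using assms by real_asymp
  show "\<forall>\<^sub>F r in at_top. m / 2 * r powr (1 - \<beta>) \<le> r * (m / (1 + rpow r \<beta>))"
    using eventually_ge_at_top[of 1]
  proof eventually_elim
    case (elim r)
    have "1 \<le> r powr \<beta>"
      using elim assms by (simp add: ge_one_powr_ge_zero)
    then have "m * r / (2 * r powr \<beta>) \<le> m * r / (1 + r powr \<beta>)"
      using elim assms by (intro divide_left_mono) auto
    then show ?case
      using elim by (simp add: rpow_def powr_diff mult.commute)
  qed
qed

lemma rpow_curvature_ratio:
  assumes "0 \<le> \<beta>" "\<beta> < 1" "0 \<le> r"
  shows "1 + rpow (3 * r) \<beta> \<le> 4 * (1 + rpow r (3 * \<beta> / 4))\<^sup>2"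
proof -
  define q where "q = rpow r (3 * \<beta> / 4)"
  have q: "0 \<le> q" "q\<^sup>2 = rpow r (3 * \<beta> / 4 + 3 * \<beta> / 4)"
    using assms rpow_add[of "3 * \<beta> / 4" "3 * \<beta> / 4" r]
    by (simp_all add: q_def rpow_nonneg power2_eq_square)
  have "(3::real) powr \<beta> \<le> 3 powr 1"
    using assms by (intro powr_mono) auto
  then have "rpow (3 * r) \<beta> \<le> 3 * rpow r \<beta>"
    by (auto simp: rpow_def powr_mult intro: mult_right_mono)
  also have "rpow r \<beta> \<le> 1 + q\<^sup>2"
  proof (cases "r \<le> 1")
    case True
    have "rpow 1 \<beta> = 1"
      by (simp add: rpow_def)
    then have "rpow r \<beta> \<le> 1"
      using True assms rpow_mono[of r 1 \<beta>] by simp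
    then show ?thesis
      using zero_le_power2[of q] by linarith
  next
    case False
    then have "r powr \<beta> \<le> r powr (3 * \<beta> / 4 + 3 * \<beta> / 4)"
      using assms by (intro powr_mono) auto
    then show ?thesis
      unfolding q(2) by (simp add: rpow_def)
  qed
  finally have "rpow (3 * r) \<beta> \<le> 3 * (1 + q\<^sup>2)"
    by simp
  then have "1 + rpow (3 * r) \<beta> \<le> 4 + 4 * q\<^sup>2"
    using zero_le_power2[of q] unfolding distrib_left by linarith
  also have "\<dots> \<le> 4 * (1 + q)\<^sup>2"
    using q(1) by (simp add: power2_eq_square algebra_simps)
  finally show ?thesis
    by (simp add: q_def)
qed

lemma rpow_curvature_antimono:
  assumes "0 \<le> a" "0 \<le> c"
  shows "antimono_on {0..} (\<lambda>r. c / (1 + rpow r a))"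
  using assms rpow_nonneg
  by (auto intro!: monotone_onI divide_left_mono rpow_mono mult_pos_pos add_pos_nonneg)

lemma convex_tail_potential_of_rpow_curvature:
  fixes U :: "'a::euclidean_space \<Rightarrow> real" and HU :: "'a \<Rightarrow> ('a \<Rightarrow>\<^sub>L 'a)"
  assumes beta: "0 \<le> \<beta>" "\<beta> < 1"
    and "\<And>x. (U has_derivative (\<lambda>h. gU x \<bullet> h)) (at x)"
    and "\<And>x. (gU has_derivative blinfun_apply (HU x)) (at x)"
    and "gU 0 = 0"
    and L: "\<And>x. norm (HU x) \<le> L"
    and m: "0 < m" and "0 \<le> b" "0 \<le> K"
    and tail: "\<And>x y. K \<le> norm x \<Longrightarrow> norm y = 1 \<Longrightarrow>
      HU x y \<bullet> y \<le> b / (1 + rpow (norm x) (3 * \<beta> / 4)) \<and> m / (1 + rpow (norm x) \<beta>) \<le> HU x y \<bullet> y"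
  shows "convex_tail_potential U gU (\<lambda>x. blinfun_apply (HU x)) (\<lambda>r. m / (1 + rpow r \<beta>))
    (\<lambda>r. b / (1 + rpow r (3 * \<beta> / 4))) L K (4 * b\<^sup>2 / m)"
proof
  fix x v :: 'a
  show "norm (HU x v) \<le> L * norm v"
    by (intro order_trans[OF norm_blinfun] mult_right_mono L) simp
  have form: "HU x v \<bullet> v = (HU x (sgn v) \<bullet> sgn v) * (norm v)\<^sup>2"
    by (intro quadratic_form_eq_sgn bounded_linear.linear blinfun.bounded_linear_right)
  assume x: "K \<le> norm x"
  have "m / (1 + rpow (norm x) \<beta>) * (norm v)\<^sup>2 \<le> HU x v \<bullet> v \<and>
      HU x v \<bullet> v \<le> b / (1 + rpow (norm x) (3 * \<beta> / 4)) * (norm v)\<^sup>2"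
  proof (cases "v = 0")
    case False
    then have "norm (sgn v) = 1"
      by (simp add: norm_sgn)
    then show ?thesis
      unfolding form using tail[OF x] by (intro conjI mult_right_mono) auto
  qed simp
  then show "m / (1 + rpow (norm x) \<beta>) * (norm v)\<^sup>2 \<le> HU x v \<bullet> v"
    "HU x v \<bullet> v \<le> b / (1 + rpow (norm x) (3 * \<beta> / 4)) * (norm v)\<^sup>2"
    by blast+
next
  fix r :: real assume r: "0 \<le> r"
  show "0 < m / (1 + rpow r \<beta>)"
    using m rpow_nonneg[of r \<beta>] by (simp add: add_pos_nonneg)
  have "b\<^sup>2 * (1 + rpow (3 * r) \<beta>) \<le> b\<^sup>2 * (4 * (1 + rpow r (3 * \<beta> / 4))\<^sup>2)"
    using rpow_curvature_ratio[OF beta r] by (intro mult_left_mono) auto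
  then show "(b / (1 + rpow r (3 * \<beta> / 4)))\<^sup>2 \<le> 4 * b\<^sup>2 / m * (m / (1 + rpow (3 * r) \<beta>))"
    using m rpow_nonneg[of "3 * r" \<beta>] rpow_nonneg[of r "3 * \<beta> / 4"]
    by (simp add: power_divide divide_simps mult_ac)
next
  show "filterlim (\<lambda>r. r * (m / (1 + rpow r \<beta>))) at_top at_top"
    using beta m by (intro rpow_curvature_growth)
qed (use assms in \<open>auto intro: rpow_curvature_antimono\<close>)

theorem theorem4:
  fixes U :: "'a::euclidean_space \<Rightarrow> real"
    and gU :: "'a \<Rightarrow> 'a"
    and HU :: "'a \<Rightarrow> ('a \<Rightarrow>\<^sub>L 'a)"
    and \<beta> L m\<^sub>\<beta> L\<^sub>\<beta> K\<^sub>\<beta> :: real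
  assumes beta: "0 \<le> \<beta>" "\<beta> < 1"
    and grad: "\<And>x. (U has_derivative (\<lambda>h. gU x \<bullet> h)) (at x)"
    and hess: "\<And>x. (gU has_derivative blinfun_apply (HU x)) (at x)"
    and hess_cont: "continuous_on UNIV HU"
    and grad0: "gU 0 = 0"
    and L: "L \<ge> 0" "\<And>x. norm (HU x) \<le> L"
    and mb: "m\<^sub>\<beta> > 0" and Lb: "L\<^sub>\<beta> \<ge> 0" and Kb: "K\<^sub>\<beta> \<ge> 0"
    and tail: "\<And>x y. norm x \<ge> K\<^sub>\<beta> \<Longrightarrow> norm y = 1 \<Longrightarrow>
          L\<^sub>\<beta> / (1 + rpow (norm x) (3 * \<beta> / 4)) \<ge> HU x y \<bullet> y
        \<and> HU x y \<bullet> y \<ge> m\<^sub>\<beta> / (1 + rpow (norm x) \<beta>)"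
  shows "\<exists>\<Gamma>>0. \<forall>\<gamma>. 0 < \<gamma> \<and> \<gamma> \<le> \<Gamma> \<longrightarrow>
           (\<exists>C \<rho>. C \<ge> 0 \<and> 0 \<le> \<rho> \<and> \<rho> < 1 \<and>
              (\<forall>x k. Vnorm (MALA_iter U gU \<gamma> k x) (pi_meas U)
                        (\<lambda>z. exp ((m\<^sub>\<beta> / 2^5) * sqrt (1 + (norm z)\<^sup>2)))
                     \<le> ereal (C * \<rho> ^ k * exp ((m\<^sub>\<beta> / 2^5) * sqrt (1 + (norm x)\<^sup>2)))))"
proof -
  interpret convex_tail_potential U gU HU "\<lambda>r. m\<^sub>\<beta> / (1 + rpow r \<beta>)"
    "\<lambda>r. L\<^sub>\<beta> / (1 + rpow r (3 * \<beta> / 4))" L K\<^sub>\<beta> "4 * L\<^sub>\<beta>\<^sup>2 / m\<^sub>\<beta>"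
    by (intro convex_tail_potential_of_rpow_curvature assms)
  have "0 < m\<^sub>\<beta> / 2^5"
    using mb by simp
  then show ?thesis
    using mala_geometric_ergodicity_small_step unfolding exp_weight_def[abs_def] by blast
qed

end
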